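(* Let $D\in\mathcal{B}(\mathbb{R}^k)$ have non-empty interior, $g\in B_b(S,D)$ be consistent, $f\in BC_\mu^{1-}([0,T]\times S\times D,\mathbb{R}^k)$, and $I$ be an admissible interval. For each $n\in\mathbb{N}$ let $\varepsilon_n\in B([0,T]\times S,\mathbb{R}_+)$ be $\mu$-dominated, $g_n\in B_b(S,D)$ be consistent, and $u_n$ be an $\varepsilon_n$-approximate solution to (M) on $I$ with $g$ replaced by $g_n$. Assume that the following three conditions hold: (i) $(g_n)_{n\in\mathbb{N}}$ and $\big(\int_0^T\varepsilon_n(t,X_t)\,\mu(dt)\big)_{n\in\mathbb{N}}$ converge uniformly to $g$ and $0$, respectively. (ii) The closure of $\{u_n(r,x)\mid n\in\mathbb{N}\}$ is included in $D$ for each $(r,x)\in I\times S$. (iii) For each $r\in I$ there is a compact set $K$ in $D$ such that $u_n(\cdot,y)\in K$ for all $n\in\mathbb{N}$ and each $y\in S$ $\mu$-a.s. on $[r,T]$. Then $(u_n)_{n\in\mathbb{N}}$ converges locally uniformly in $t\in I$ and uniformly in $x\in S$ to the unique $\mu$-admissible solution to (M) on $I$.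
   Context: **Spaces.** $S$ is a separable metrizable topological space, $T>0$, $\mu$ is an atomless Borel measure on $[0,T]$, $k\in\mathbb{N}$, $|\cdot|$ is the Euclidean norm. $[0,T]\times S$ carries a pseudometric $d_S$ whose topology is coarser than or equal to the product topology; $\mathcal{B}(I\times S)$ and Borel measurability on $I\times S$ ($I\subset[0,T]$ an interval) refer to $d_S$. A map $u$ on $I\times S$ is consistent if $u(r,x)=u(s,y)$ whenever $d_S((r,x),(s,y))=0$. A map $g$ on $S$ is consistent if $g(x)=g(y)$ whenever $d_S((T,x),(T,y))=0$. $B(S,D)$, $B(I\times S,D)$ are the sets of $D$-valued Borel measurable maps; $B_b$ denotes the bounded ones. **Markov process.** $\mathcal{X}=(X,(\mathcal{F}_t)_{t\in[0,T]},\mathbb{P})$ is a fixed consistent progressive Markov process on a measurable space $(\Omega,\mathcal{F})$ with state space $S$ and Borel measurable transition probabilities: $X:[0,T]\times\Omega\to S$ is a process adapted to the filtration $(\mathcal{F}_t)$, $\mathbb{P}=\{P_{r,x}\mid(r,x)\in[0,T]\times S\}$ is a set of probability measures on $(\Omega,\mathcal{F})$ (expectations $E_{r,x}$), and: (1) for each $(s,y)$, $P_{s,y}$-a.s. $d_S((r,X_r),(r,y))=0$ for all $r\in[0,s]$; (2) $[0,t]\times S\to[0,1]$, $(s,x)\mapsto P_{s,x}(X_t\in B)$ is consistent and Borel measurable for all $t\in[0,T]$, $B\in\mathcal{B}(S)$; (3) $P_{r,x}(X_t\in B\mid\mathcal{F}_s)=P_{s,X_s}(X_t\in B)$ $P_{r,x}$-a.s.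 for all $r\le s\le t$, $x\in S$, $B\in\mathcal{B}(S)$; (4) $X$ is progressively measurable with respect to its natural filtration and its natural backward filtration. **Regularity with respect to $\mu$.** A property of $(s,y)$ holds "for all $y\in S$ $\mu$-a.s. on $J$" if there is a $\mu$-null set $N$ such that it holds for all $s\in J\setminus N$ and all $y\in S$. $a\in B([0,T]\times S,\mathbb{R}_+)$ is $\mu$-dominated if there is a $\mu$-integrable $\overline a\in B([0,T],\mathbb{R}_+)$ with $a(\cdot,y)\le\overline a$ for all $y\in S$ $\mu$-a.s. on $[0,T]$. A $\mathcal{B}([0,T]\times S)\otimes\mathcal{B}(D)$-measurable $f:[0,T]\times S\times D\to\mathbb{R}^k$ is locally $\mu$-bounded (resp. locally Lipschitz $\mu$-continuous) if each $\hat w\in D$ has a neighborhood $W$ in $\overline D$ and a $\mu$-dominated $\lambda\in B([0,T]\times S,\mathbb{R}_+)$ such that $|f(t,x,w)|\le\lambda(t,x)$ (resp. $|f(t,x,w)-f(t,x,w')|\le\lambda(t,x)|w-w'|$) for all $(t,x)\in[0,T]\times S$ and $w,w'\in W\cap D$. $BC_\mu^{1-}([0,T]\times S\times D,\mathbb{R}^k)$ is the set of all $\mathcal{B}([0,T]\times S)\otimes\mathcal{B}(D)$-measurable maps that are locally $\mu$-bounded and locally Lipschitz $\mu$-continuous. **Problem (M).** An interval $I$ is admissible if $I=(t,T]$ or $I=[t,T]$ for some $t\in[0,T)$. For $\mu$-dominated $\varepsilon\in B([0,T]\times S,\mathbb{R}_+)$, an $\varepsilon$-approximate solution to (M) (with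 data $f,g$) on an admissible interval $I$ is a consistent $u\in B(I\times S,D)$ such that for all $r\le t$ in $I$ and $x\in S$, $|u(t,X_t)|$ and $\int_r^t|f(s,X_s,u(s,X_s))|\,\mu(ds)$ are finite and $P_{r,x}$-integrable, $$\Big|E_{r,x}[u(t,X_t)]-u(r,x)-E_{r,x}\Big[\int_r^tf(s,X_s,u(s,X_s))\,\mu(ds)\Big]\Big|\le E_{r,x}\Big[\int_r^t\varepsilon(s,X_s)\,\mu(ds)\Big],$$ and $u(T,x)=g(x)$. A solution is a $0$-approximate solution. A solution $u$ on $I$ is $\mu$-admissible if for each $r\in I$ there is a $\mu$-null set $N\in\mathcal{B}([0,T])$ such that $u((N^c\cap[r,T])\times S)$ is relatively compact in $D$ (its closure is a compact subset of $D$). In (i), the convergence is uniform on $S$ and on $\Omega$, respectively. Convergence "locally uniformly in $t\in I$ and uniformly in $x\in S$" means uniform convergence on $[r,T]\times S$ for every $r\in I$. *)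

theory Defs
  imports "HOL-Probability.Probability"
begin

section \<open>Spaces\<close>

definition borel_of :: "'a topology \<Rightarrow> 'a measure" where
  "borel_of X = sigma (topspace X) {U. openin X U}"

definition pseudometric_on :: "'a set \<Rightarrow> ('a \<Rightarrow> 'a \<Rightarrow> real) \<Rightarrow> bool" where
  "pseudometric_on C d \<longleftrightarrow>
     (\<forall>p\<in>C. \<forall>q\<in>C. 0 \<le> d p q \<and> d p q = d q p) \<and>
     (\<forall>p\<in>C. d p p = 0) \<and>
     (\<forall>p\<in>C. \<forall>q\<in>C. \<forall>z\<in>C. d p z \<le> d p q + d q z)"

definition pseudometric_topology :: "'a set \<Rightarrow> ('a \<Rightarrow> 'a \<Rightarrow> real) \<Rightarrow> 'a topology" where
  "pseudometric_topology C d =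
     topology (\<lambda>U. U \<subseteq> C \<and> (\<forall>p\<in>U. \<exists>e>0. \<forall>q\<in>C. d p q < e \<longrightarrow> q \<in> U))"

lemma openin_pseudometric_topology:
  "openin (pseudometric_topology C d) U \<longleftrightarrow>
     U \<subseteq> C \<and> (\<forall>p\<in>U. \<exists>e>0. \<forall>q\<in>C. d p q < e \<longrightarrow> q \<in> U)"
proof -
  let ?L = "\<lambda>U. U \<subseteq> C \<and> (\<forall>p\<in>U. \<exists>e>0. \<forall>q\<in>C. d p q < e \<longrightarrow> q \<in> U)"
  have "istopology ?L"
    unfolding istopology_def
  proof (intro conjI allI impI)
    fix A B
    assume A: "?L A" and B: "?L B"
    show "A \<inter> B \<subseteq> C" using A by blast
    show "\<forall>p\<in>A \<inter> B. \<exists>e>0. \<forall>q\<in>C. d p q < e \<longrightarrow> q \<in> A \<inter> B"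
    proof
      fix p assume p: "p \<in> A \<inter> B"
      obtain a where "a > 0" "\<forall>q\<in>C. d p q < a \<longrightarrow> q \<in> A" using A p by blast
      moreover obtain b where "b > 0" "\<forall>q\<in>C. d p q < b \<longrightarrow> q \<in> B" using B p by blast
      ultimately show "\<exists>e>0. \<forall>q\<in>C. d p q < e \<longrightarrow> q \<in> A \<inter> B"
        by (intro exI[of _ "min a b"]) auto
    qed
  next
    fix K assume K: "\<forall>A\<in>K. ?L A"
    show "\<Union>K \<subseteq> C" using K by blast
    show "\<forall>p\<in>\<Union>K. \<exists>e>0. \<forall>q\<in>C. d p q < e \<longrightarrow> q \<in> \<Union>K" using K by (meson UnionE UnionI)
  qed
  then show ?thesis by (simp add: pseudometric_topology_def topology_inverse')
qed

lemma topspace_pseudometric_topology [simp]: "topspace (pseudometric_topology C d) = C"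
  unfolding topspace_def openin_pseudometric_topology by (auto intro!: exI[of _ C] exI[of _ "1::real"])

text \<open>Maps on \<open>I \<times> S\<close> and \<open>[0,T] \<times> S \<times> D\<close> take (nested) pairs. Only their values on these
  sets matter.

  \<open>time_borel S d I\<close> is the Borel sigma-algebra of \<open>I \<times> S\<close> for the pseudometric \<open>d\<close>; restricting
  \<open>d\<close> to \<open>I \<times> S\<close> induces the subspace topology.\<close>

definition time_borel ::
  "'s topology \<Rightarrow> (real \<times> 's \<Rightarrow> real \<times> 's \<Rightarrow> real) \<Rightarrow> real set \<Rightarrow> (real \<times> 's) measure" where
  "time_borel S d I = borel_of (pseudometric_topology (I \<times> topspace S) d)"

definition consistent_on ::
  "'s topology \<Rightarrow> (real \<times> 's \<Rightarrow> real \<times> 's \<Rightarrow> real) \<Rightarrow> real set \<Rightarrow> (real \<times> 's \<Rightarrow> 'b) \<Rightarrow> bool" where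
  "consistent_on S d I u \<longleftrightarrow>
     (\<forall>p \<in> I \<times> topspace S. \<forall>q \<in> I \<times> topspace S. d p q = 0 \<longrightarrow> u p = u q)"

definition terminal_consistent ::
  "real \<Rightarrow> 's topology \<Rightarrow> (real \<times> 's \<Rightarrow> real \<times> 's \<Rightarrow> real) \<Rightarrow> ('s \<Rightarrow> 'b) \<Rightarrow> bool" where
  "terminal_consistent T S d g \<longleftrightarrow>
     (\<forall>x \<in> topspace S. \<forall>y \<in> topspace S. d (T, x) (T, y) = 0 \<longrightarrow> g x = g y)"

definition bounded_borel_maps ::
  "'s topology \<Rightarrow> 'b::euclidean_space set \<Rightarrow> ('s \<Rightarrow> 'b) set" where
  "bounded_borel_maps S D =
     {g \<in> measurable (borel_of S) (restrict_space borel D). bounded (g ` topspace S)}"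

definition atomless :: "'a measure \<Rightarrow> bool" where
  "atomless M \<longleftrightarrow>
     (\<forall>A\<in>sets M. 0 < emeasure M A \<longrightarrow>
        (\<exists>B\<in>sets M. B \<subseteq> A \<and> 0 < emeasure M B \<and> emeasure M B < emeasure M A))"

section \<open>Markov processes\<close>

definition generated_sigma :: "'w set \<Rightarrow> 's measure \<Rightarrow> (real \<Rightarrow> 'w \<Rightarrow> 's) \<Rightarrow> real set \<Rightarrow> 'w measure" where
  "generated_sigma \<Omega> N X J = sigma \<Omega> {X s -` B \<inter> \<Omega> | s B. s \<in> J \<and> B \<in> sets N}"

text \<open>\<open>M\<close> stands for the underlying measurable space; its measure plays no role. The sigma-algebra
  \<open>generated_sigma (space M) (borel_of S) X J\<close> is the natural filtration at \<open>t\<close> for \<open>J = [0,t]\<close>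
  and the natural backward filtration at \<open>t\<close> for \<open>J = [t,T]\<close>.\<close>

locale progressive_markov_process =
  fixes T :: real
    and S :: "'s topology"
    and d :: "real \<times> 's \<Rightarrow> real \<times> 's \<Rightarrow> real"
    and M :: "'w measure"
    and F :: "real \<Rightarrow> 'w measure"
    and X :: "real \<Rightarrow> 'w \<Rightarrow> 's"
    and P :: "real \<times> 's \<Rightarrow> 'w measure"
  assumes filtration_subalgebra: "t \<in> {0..T} \<Longrightarrow> subalgebra M (F t)"
    and filtration_mono: "0 \<le> s \<Longrightarrow> s \<le> t \<Longrightarrow> t \<le> T \<Longrightarrow> sets (F s) \<subseteq> sets (F t)"
    and adapted: "t \<in> {0..T} \<Longrightarrow> X t \<in> measurable (F t) (borel_of S)"
    and prob: "p \<in> {0..T} \<times> topspace S \<Longrightarrow> prob_space (P p)"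
    and sets_P: "p \<in> {0..T} \<times> topspace S \<Longrightarrow> sets (P p) = sets M"
    and start: "s \<in> {0..T} \<Longrightarrow> y \<in> topspace S \<Longrightarrow>
      AE \<omega> in P (s, y). \<forall>r\<in>{0..s}. d (r, X r \<omega>) (r, y) = 0"
    and transition_consistent: "t \<in> {0..T} \<Longrightarrow> B \<in> sets (borel_of S) \<Longrightarrow>
      consistent_on S d {0..t} (\<lambda>p. measure (P p) {\<omega> \<in> space M. X t \<omega> \<in> B})"
    and transition_measurable: "t \<in> {0..T} \<Longrightarrow> B \<in> sets (borel_of S) \<Longrightarrow>
      (\<lambda>p. measure (P p) {\<omega> \<in> space M. X t \<omega> \<in> B}) \<in> borel_measurable (time_borel S d {0..t})"
    and markov: "0 \<le> r \<Longrightarrow> r \<le> s \<Longrightarrow> s \<le> t \<Longrightarrow> t \<le> T \<Longrightarrow> x \<in> topspace S \<Longrightarrow>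
      B \<in> sets (borel_of S) \<Longrightarrow>
      AE \<omega> in P (r, x).
        real_cond_exp (P (r, x)) (F s) (indicator {\<omega> \<in> space M. X t \<omega> \<in> B}) \<omega> =
        measure (P (s, X s \<omega>)) {\<omega>' \<in> space M. X t \<omega>' \<in> B}"
    and progressive: "t \<in> {0..T} \<Longrightarrow>
      (\<lambda>(s, \<omega>). X s \<omega>) \<in> measurable
        (restrict_space borel {0..t} \<Otimes>\<^sub>M generated_sigma (space M) (borel_of S) X {0..t}) (borel_of S)"
    and backward_progressive: "t \<in> {0..T} \<Longrightarrow>
      (\<lambda>(s, \<omega>). X s \<omega>) \<in> measurable
        (restrict_space borel {t..T} \<Otimes>\<^sub>M generated_sigma (space M) (borel_of S) X {t..T}) (borel_of S)"

section \<open>Regularity with respect to \<open>\<mu>\<close>\<close>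

definition mu_dominated ::
  "real \<Rightarrow> 's topology \<Rightarrow> (real \<times> 's \<Rightarrow> real \<times> 's \<Rightarrow> real) \<Rightarrow> real measure \<Rightarrow> (real \<times> 's \<Rightarrow> real) \<Rightarrow> bool" where
  "mu_dominated T S d \<mu> a \<longleftrightarrow>
     a \<in> measurable (time_borel S d {0..T}) (restrict_space borel {0..}) \<and>
     (\<exists>a'. a' \<in> measurable (restrict_space borel {0..T}) (restrict_space borel {0..}) \<and>
       integrable \<mu> a' \<and> (AE s in \<mu>. \<forall>y\<in>topspace S. a (s, y) \<le> a' s))"

definition neighborhood_in :: "'a::topological_space set \<Rightarrow> 'a \<Rightarrow> 'a set \<Rightarrow> bool" where
  "neighborhood_in Y w W \<longleftrightarrow> W \<subseteq> Y \<and> (\<exists>V. openin (top_of_set Y) V \<and> w \<in> V \<and> V \<subseteq> W)"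

definition locally_mu_bounded ::
  "real \<Rightarrow> 's topology \<Rightarrow> (real \<times> 's \<Rightarrow> real \<times> 's \<Rightarrow> real) \<Rightarrow> real measure \<Rightarrow>
   'b::euclidean_space set \<Rightarrow> ((real \<times> 's) \<times> 'b \<Rightarrow> 'b) \<Rightarrow> bool" where
  "locally_mu_bounded T S d \<mu> D f \<longleftrightarrow>
     (\<forall>w0\<in>D. \<exists>W l. neighborhood_in (closure D) w0 W \<and> mu_dominated T S d \<mu> l \<and>
        (\<forall>p \<in> {0..T} \<times> topspace S. \<forall>w \<in> W \<inter> D. norm (f (p, w)) \<le> l p))"

definition locally_Lipschitz_mu_continuous ::
  "real \<Rightarrow> 's topology \<Rightarrow> (real \<times> 's \<Rightarrow> real \<times> 's \<Rightarrow> real) \<Rightarrow> real measure \<Rightarrow>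
   'b::euclidean_space set \<Rightarrow> ((real \<times> 's) \<times> 'b \<Rightarrow> 'b) \<Rightarrow> bool" where
  "locally_Lipschitz_mu_continuous T S d \<mu> D f \<longleftrightarrow>
     (\<forall>w0\<in>D. \<exists>W l. neighborhood_in (closure D) w0 W \<and> mu_dominated T S d \<mu> l \<and>
        (\<forall>p \<in> {0..T} \<times> topspace S. \<forall>w \<in> W \<inter> D. \<forall>w' \<in> W \<inter> D.
           norm (f (p, w) - f (p, w')) \<le> l p * norm (w - w')))"

definition BC1minus ::
  "real \<Rightarrow> 's topology \<Rightarrow> (real \<times> 's \<Rightarrow> real \<times> 's \<Rightarrow> real) \<Rightarrow> real measure \<Rightarrow>
   'b::euclidean_space set \<Rightarrow> ((real \<times> 's) \<times> 'b \<Rightarrow> 'b) set" where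
  "BC1minus T S d \<mu> D =
     {f \<in> borel_measurable (time_borel S d {0..T} \<Otimes>\<^sub>M restrict_space borel D).
        locally_mu_bounded T S d \<mu> D f \<and> locally_Lipschitz_mu_continuous T S d \<mu> D f}"

section \<open>The Markovian integral equation\<close>

definition admissible_interval :: "real \<Rightarrow> real set \<Rightarrow> bool" where
  "admissible_interval T I \<longleftrightarrow> (\<exists>t. 0 \<le> t \<and> t < T \<and> (I = {t<..T} \<or> I = {t..T}))"

text \<open>Finiteness of the pathwise integral of \<open>\<bar>f(s, X\<^sub>s, u(s, X\<^sub>s))\<bar>\<close> is expressed by
  \<^const>\<open>set_integrable\<close>, for every \<open>\<omega>\<close>. As \<open>\<mu>\<close> is atomless, it does not matter
  whether the end points belong to the domain of integration.\<close>

definition approx_solution ::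
  "real \<Rightarrow> 's topology \<Rightarrow> (real \<times> 's \<Rightarrow> real \<times> 's \<Rightarrow> real) \<Rightarrow> 'w measure \<Rightarrow>
   (real \<Rightarrow> 'w \<Rightarrow> 's) \<Rightarrow> (real \<times> 's \<Rightarrow> 'w measure) \<Rightarrow> real measure \<Rightarrow>
   'b::euclidean_space set \<Rightarrow> ((real \<times> 's) \<times> 'b \<Rightarrow> 'b) \<Rightarrow> ('s \<Rightarrow> 'b) \<Rightarrow>
   (real \<times> 's \<Rightarrow> real) \<Rightarrow> real set \<Rightarrow> (real \<times> 's \<Rightarrow> 'b) \<Rightarrow> bool" where
  "approx_solution T S d M X P \<mu> D f g \<epsilon> I u \<longleftrightarrow>
     u \<in> measurable (time_borel S d I) (restrict_space borel D) \<and>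
     consistent_on S d I u \<and>
     (\<forall>r\<in>I. \<forall>t\<in>I. \<forall>x\<in>topspace S. r \<le> t \<longrightarrow>
        integrable (P (r, x)) (\<lambda>\<omega>. norm (u (t, X t \<omega>))) \<and>
        (\<forall>\<omega>\<in>space M. set_integrable \<mu> {r..t} (\<lambda>s. f ((s, X s \<omega>), u (s, X s \<omega>)))) \<and>
        integrable (P (r, x))
          (\<lambda>\<omega>. LINT s:{r..t}|\<mu>. norm (f ((s, X s \<omega>), u (s, X s \<omega>)))) \<and>
        norm ((LINT \<omega>|P (r, x). u (t, X t \<omega>)) - u (r, x)
              - (LINT \<omega>|P (r, x). (LINT s:{r..t}|\<mu>. f ((s, X s \<omega>), u (s, X s \<omega>)))))
        \<le> (LINT \<omega>|P (r, x). (LINT s:{r..t}|\<mu>. \<epsilon> (s, X s \<omega>)))) \<and>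
     (\<forall>x\<in>topspace S. u (T, x) = g x)"

definition solution ::
  "real \<Rightarrow> 's topology \<Rightarrow> (real \<times> 's \<Rightarrow> real \<times> 's \<Rightarrow> real) \<Rightarrow> 'w measure \<Rightarrow>
   (real \<Rightarrow> 'w \<Rightarrow> 's) \<Rightarrow> (real \<times> 's \<Rightarrow> 'w measure) \<Rightarrow> real measure \<Rightarrow>
   'b::euclidean_space set \<Rightarrow> ((real \<times> 's) \<times> 'b \<Rightarrow> 'b) \<Rightarrow> ('s \<Rightarrow> 'b) \<Rightarrow>
   real set \<Rightarrow> (real \<times> 's \<Rightarrow> 'b) \<Rightarrow> bool" where
  "solution T S d M X P \<mu> D f g I u \<longleftrightarrow> approx_solution T S d M X P \<mu> D f g (\<lambda>_. 0) I u"

definition mu_admissible ::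
  "real \<Rightarrow> 's topology \<Rightarrow> real measure \<Rightarrow> 'b::euclidean_space set \<Rightarrow> real set \<Rightarrow>
   (real \<times> 's \<Rightarrow> 'b) \<Rightarrow> bool" where
  "mu_admissible T S \<mu> D I u \<longleftrightarrow>
     (\<forall>r\<in>I. \<exists>N\<in>null_sets \<mu>.
        compact (closure (u ` (({r..T} - N) \<times> topspace S))) \<and>
        closure (u ` (({r..T} - N) \<times> topspace S)) \<subseteq> D)"

end

theory Submission
  imports Defs
begin

text \<open>A compact \<open>K \<subseteq> D\<close> containing the values of two approximate solutions \<open>u\<close> and \<open>v\<close> on \<open>[r, T]\<close>
  admits one \<open>\<mu>\<close>-integrable \<open>l\<close> depending on time only that bounds \<open>f\<close> and its Lipschitz constant on
  \<open>K\<close>. Comparing the two integral equations on \<open>[r, T]\<close> gives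
  \<open>\<bar>u - v\<bar>(r, x) \<le> \<delta> + E\<^bsub>r,x\<^esub>[\<integral> l(s) \<bar>u - v\<bar>(s, X\<^sub>s) \<mu>(ds)]\<close>, where \<open>\<delta>\<close> collects the
  errors in the terminal values and in the equations. Since \<open>l\<close> is deterministic and \<open>\<mu>\<close> has no
  atoms, bounding \<open>\<bar>u - v\<bar>\<close> by constants on consecutive time intervals of \<open>l \<mu>\<close>-mass at most \<open>1/2\<close>
  yields \<open>\<bar>u - v\<bar> \<le> c \<delta>\<close> on \<open>[r, T] \<times> S\<close>. Hence the sequence is uniformly Cauchy, its limit solves
  the equation by the Lipschitz bound, and \<open>\<delta> = 0\<close> gives uniqueness.\<close>

subsection \<open>Borel maps into \<open>I \<times> S\<close>\<close>

lemma space_borel_of [simp]: "space (borel_of X) = topspace X"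
  by (simp add: borel_of_def space_measure_of_conv)

lemma sets_borel_of: "sets (borel_of X) = sigma_sets (topspace X) {U. openin X U}"
  unfolding borel_of_def by (rule sets_measure_of) (auto dest: openin_subset)

lemma openin_in_sets_borel_of: "openin X U \<Longrightarrow> U \<in> sets (borel_of X)"
  by (simp add: sets_borel_of)

lemma measurable_borel_ofI:
  assumes "\<And>x. x \<in> space N \<Longrightarrow> h x \<in> topspace X"
    and "\<And>U. openin X U \<Longrightarrow> h -` U \<inter> space N \<in> sets N"
  shows "h \<in> measurable N (borel_of X)"
  unfolding borel_of_def using assms by (intro measurable_measure_of) (auto dest: openin_subset)

lemma space_time_borel [simp]: "space (time_borel S d J) = J \<times> topspace S"
  by (simp add: time_borel_def)

text \<open>\<open>V\<close> is the union of all balls in \<open>C\<close> about points of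
  \<open>U\<close> whose trace on \<open>C'\<close> stays in \<open>U\<close>. The triangle
  inequality makes it open, and no point of \<open>C'\<close> is added. Thus the metric topology of
  a subset is the subspace topology.\<close>

lemma openin_pseudometric_topology_extend:
  assumes d: "pseudometric_on C d" and "C' \<subseteq> C" and U: "openin (pseudometric_topology C' d) U"
  obtains V where "openin (pseudometric_topology C d) V" "U = V \<inter> C'"
proof
  define V where "V = {p \<in> C. \<exists>q\<in>U. \<exists>e>0. d q p < e \<and> (\<forall>z\<in>C'. d q z < e \<longrightarrow> z \<in> U)}"
  have U': "U \<subseteq> C'" "\<And>p. p \<in> U \<Longrightarrow> \<exists>e>0. \<forall>q\<in>C'. d p q < e \<longrightarrow> q \<in> U"
    using U by (auto simp: openin_pseudometric_topology)
  have tri: "d p z \<le> d p q + d q z" if "p \<in> C" "q \<in> C" "z \<in> C" for p q z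
    using d that by (auto simp: pseudometric_on_def)
  have refl: "d p p = 0" if "p \<in> C" for p
    using d that by (auto simp: pseudometric_on_def)
  show "openin (pseudometric_topology C d) V"
    unfolding openin_pseudometric_topology
  proof (intro conjI ballI)
    show "V \<subseteq> C" by (auto simp: V_def)
    fix p assume "p \<in> V"
    then obtain q e where p: "p \<in> C" and q: "q \<in> U" "e > 0" "d q p < e"
      "\<forall>z\<in>C'. d q z < e \<longrightarrow> z \<in> U" by (auto simp: V_def)
    have "q \<in> C" using q U' assms by auto
    show "\<exists>e>0. \<forall>q\<in>C. d p q < e \<longrightarrow> q \<in> V"
    proof (intro exI[of _ "e - d q p"] conjI ballI impI)
      show "e - d q p > 0" using q by simp
      fix z assume z: "z \<in> C" "d p z < e - d q p"
      have "d q z < e" using tri[OF \<open>q \<in> C\<close> p z(1)] z(2) by simp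
      then show "z \<in> V" using z q by (auto simp: V_def)
    qed
  qed
  show "U = V \<inter> C'"
  proof
    show "V \<inter> C' \<subseteq> U" by (auto simp: V_def)
    show "U \<subseteq> V \<inter> C'"
    proof
      fix p assume "p \<in> U"
      then have "p \<in> C'" "p \<in> C" using U' assms by auto
      then have "d p p = 0" by (simp add: refl)
      moreover obtain e where "e > 0" "\<forall>z\<in>C'. d p z < e \<longrightarrow> z \<in> U"
        using U'(2)[OF \<open>p \<in> U\<close>] by blast
      ultimately have "\<exists>q\<in>U. \<exists>e>0. d q p < e \<and> (\<forall>z\<in>C'. d q z < e \<longrightarrow> z \<in> U)"
        using \<open>p \<in> U\<close> by (intro bexI[of _ p] exI[of _ e]) auto
      then show "p \<in> V \<inter> C'" using \<open>p \<in> C\<close> \<open>p \<in> C'\<close> by (simp add: V_def)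
    qed
  qed
qed

text \<open>The base consists of the balls of radius \<open>1 / Suc n\<close> about the points of a
  countable dense set.\<close>

lemma separable_metrizable_countable_base:
  assumes "metrizable_space S" "separable_space S"
  obtains \<B> where "countable \<B>" "\<And>B. B \<in> \<B> \<Longrightarrow> openin S B"
    "\<And>U x. openin S U \<Longrightarrow> x \<in> U \<Longrightarrow> \<exists>B\<in>\<B>. x \<in> B \<and> B \<subseteq> U"
proof -
  from assms(1) obtain M m where "Metric_space M m" and S: "S = Metric_space.mtopology M m"
    by (auto simp: metrizable_space_def)
  then interpret Metric_space M m by simp
  obtain C where C: "countable C" "C \<subseteq> M" "mtopology closure_of C = M"
    using assms(2) S by (auto simp: separable_space_def)
  show ?thesis
  proof (rule that)
    show "countable ((\<lambda>(c, n). mball c (1 / Suc n)) ` (C \<times> (UNIV :: nat set)))"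
      using C by blast
    show "openin S B" if "B \<in> (\<lambda>(c, n). mball c (1 / Suc n)) ` (C \<times> (UNIV :: nat set))" for B
      using that S by auto
    fix U x assume U: "openin S U" "x \<in> U"
    then have "x \<in> M" using S openin_subset by fastforce
    from U obtain e where e: "e > 0" "mball x e \<subseteq> U"
      using S openin_mtopology by blast
    \<comment> \<open>Half of \<open>e\<close>: a centre \<open>c\<close> within
      \<open>1 / Suc n\<close> of \<open>x\<close> then has its whole ball of that radius inside
      \<open>mball x e\<close>.\<close>
    then obtain n where n: "1 / Suc n < e / 2"
      using nat_approx_posE[of "e / 2"] by (metis half_gt_zero)
    have "x \<in> mtopology closure_of C" using C \<open>x \<in> M\<close> by simp
    then have "\<forall>r>0. \<exists>c\<in>C. c \<in> mball x r" unfolding metric_closure_of by blast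
    then obtain c where c: "c \<in> C" "c \<in> mball x (1 / Suc n)"
      by (meson of_nat_0_less_iff zero_less_Suc zero_less_divide_1_iff)
    have "mball c (1 / Suc n) \<subseteq> mball x e"
    proof
      fix z assume z: "z \<in> mball c (1 / Suc n)"
      have "m x z \<le> m x c + m c z" using z c C \<open>x \<in> M\<close> by (intro triangle) auto
      also have "\<dots> < e" using z c n by simp
      finally show "z \<in> mball x e" using z \<open>x \<in> M\<close> by simp
    qed
    then show "\<exists>B\<in>(\<lambda>(c, n). mball c (1 / Suc n)) ` (C \<times> (UNIV :: nat set)). x \<in> B \<and> B \<subseteq> U"
      using c e \<open>x \<in> M\<close> by (intro bexI[of _ "mball c (1 / Suc n)"]) (auto simp: commute)
  qed
qed

text \<open>A \<open>d\<close>-open set is open in the product topology. Both factors are second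
  countable, so this set is a countable union of open rectangles. Its preimage is then a countable
  union of sets on which \<open>a\<close> and \<open>b\<close> are each constrained
  separately.\<close>

lemma measurable_time_borel:
  assumes S: "metrizable_space S" "separable_space S"
    and d: "pseudometric_on ({0..T} \<times> topspace S) d"
    and d_coarser: "\<And>U. openin (pseudometric_topology ({0..T} \<times> topspace S) d) U \<Longrightarrow>
      openin (prod_topology (top_of_set {0..T}) S) U"
    and J: "J \<subseteq> {0..T}"
    and a: "a \<in> borel_measurable N" "\<And>x. x \<in> space N \<Longrightarrow> a x \<in> J"
    and b: "b \<in> measurable N (borel_of S)"
  shows "(\<lambda>x. (a x, b x)) \<in> measurable N (time_borel S d J)"
  unfolding time_borel_def
proof (rule measurable_borel_ofI)
  have bS: "b x \<in> topspace S" if "x \<in> space N" for x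
    using measurable_space[OF b that] by simp
  show "(a x, b x) \<in> topspace (pseudometric_topology (J \<times> topspace S) d)" if "x \<in> space N" for x
    using that a bS by auto
  fix U assume "openin (pseudometric_topology (J \<times> topspace S) d) U"
  then obtain V where V: "openin (pseudometric_topology ({0..T} \<times> topspace S) d) V"
      "U = V \<inter> J \<times> topspace S"
    using openin_pseudometric_topology_extend[OF d, of "J \<times> topspace S" U] J by blast
  have oV: "openin (prod_topology (top_of_set {0..T}) S) V" by (rule d_coarser[OF V(1)])
  obtain \<B> where \<B>: "countable \<B>" "\<And>B. B \<in> \<B> \<Longrightarrow> openin S B"
    "\<And>U x. openin S U \<Longrightarrow> x \<in> U \<Longrightarrow> \<exists>B\<in>\<B>. x \<in> B \<and> B \<subseteq> U"
    using separable_metrizable_countable_base[OF S] by metis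
  obtain \<A> :: "real set set" where \<A>: "countable \<A>" "topological_basis \<A>"
    using ex_countable_basis by blast
  \<comment> \<open>Pairs of basic sets whose rectangle lies in \<open>V\<close>. There are
    countably many, and they cover \<open>V\<close>.\<close>
  define \<R> where "\<R> = {(A, B). A \<in> \<A> \<and> B \<in> \<B> \<and> ({0..T} \<inter> A) \<times> B \<subseteq> V}"
  have "\<R> \<subseteq> \<A> \<times> \<B>" by (auto simp: \<R>_def)
  then have cR: "countable \<R>" by (rule countable_subset) (use \<A>(1) \<B>(1) in simp)
  have R: "A \<in> \<A>" "B \<in> \<B>" "({0..T} \<inter> A) \<times> B \<subseteq> V" if "(A, B) \<in> \<R>" for A B
    using that unfolding \<R>_def by simp_all
  have V_R: "\<exists>A B. (A, B) \<in> \<R> \<and> s \<in> A \<and> y \<in> B" if sy: "(s, y) \<in> V" for s y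
  proof -
    obtain A0 B0 where AB: "openin (top_of_set {0..T}) A0" "openin S B0" "s \<in> A0" "y \<in> B0"
      "A0 \<times> B0 \<subseteq> V"
      using oV sy unfolding openin_prod_topology_alt by metis
    obtain A1 where A1: "open A1" "A0 = {0..T} \<inter> A1"
      using AB(1) unfolding openin_open by metis
    obtain A where A: "A \<in> \<A>" "s \<in> A" "A \<subseteq> A1"
      using topological_basisE[OF \<A>(2) A1(1)] AB(3) A1(2) by (metis IntD2)
    obtain B where B: "B \<in> \<B>" "y \<in> B" "B \<subseteq> B0" using \<B>(3)[OF AB(2,4)] by metis
    have "({0..T} \<inter> A) \<times> B \<subseteq> V" using A(3) B(3) A1(2) AB(5) by blast
    then show ?thesis using A B unfolding \<R>_def by blast
  qed
  have "(\<lambda>x. (a x, b x)) -` U \<inter> space N =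
      (\<Union>(A, B)\<in>\<R>. (a -` A \<inter> space N) \<inter> (b -` B \<inter> space N))" (is "?L = ?R")
  proof (rule set_eqI)
    fix x
    show "x \<in> ?L \<longleftrightarrow> x \<in> ?R"
    proof
      assume "x \<in> ?L"
      then have x: "x \<in> space N" "(a x, b x) \<in> V" using V(2) by auto
      then obtain A B where "(A, B) \<in> \<R>" "a x \<in> A" "b x \<in> B" using V_R by blast
      then show "x \<in> ?R" using x by blast
    next
      assume "x \<in> ?R"
      then obtain A B where AB: "(A, B) \<in> \<R>" "a x \<in> A" "b x \<in> B" and x: "x \<in> space N" by blast
      have "a x \<in> {0..T} \<inter> A" using a(2)[OF x] J AB by blast
      then have "(a x, b x) \<in> V" using R(3)[OF AB(1)] AB(3) by blast
      then show "x \<in> ?L" using V(2) x a(2)[OF x] bS[OF x] by simp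
    qed
  qed
  also have "\<dots> \<in> sets N"
  proof (intro sets.countable_UN'' cR)
    fix p assume p: "p \<in> \<R>"
    obtain A B where AB: "p = (A, B)" by (cases p)
    have "a -` A \<inter> space N \<in> sets N"
      using a(1) topological_basis_open[OF \<A>(2) R(1)] p AB by (auto intro: measurable_sets)
    moreover have "b -` B \<inter> space N \<in> sets N"
      using measurable_sets[OF b openin_in_sets_borel_of[OF \<B>(2)[OF R(2)]]] p AB by blast
    ultimately show "(case p of (A, B) \<Rightarrow> (a -` A \<inter> space N) \<inter> (b -` B \<inter> space N)) \<in> sets N"
      by (simp add: AB)
  qed
  finally show "(\<lambda>x. (a x, b x)) -` U \<inter> space N \<in> sets N" .
qed

text \<open>This lets a map that is defined on \<open>I\<close> only be paired with a driver that is
  measurable on all of \<open>[0,T]\<close>.\<close>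

lemma measurable_ident_time_borel:
  assumes "J \<subseteq> J'"
  shows "(\<lambda>p. p) \<in> measurable (time_borel S d J) (time_borel S d J')"
  unfolding time_borel_def[of S d J']
proof (rule measurable_borel_ofI)
  show "p \<in> topspace (pseudometric_topology (J' \<times> topspace S) d)"
    if "p \<in> space (time_borel S d J)" for p
    using that assms by auto
  fix U assume "openin (pseudometric_topology (J' \<times> topspace S) d) U"
  then have "openin (pseudometric_topology (J \<times> topspace S) d) (U \<inter> J \<times> topspace S)"
    unfolding openin_pseudometric_topology using assms by blast
  then show "(\<lambda>p. p) -` U \<inter> space (time_borel S d J) \<in> sets (time_borel S d J)"
    by (simp add: time_borel_def openin_in_sets_borel_of)
qed

subsection \<open>A backward Gronwall inequality\<close>

text \<open>One step of the recursion solves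
  \<open>A \<le> \<delta> + A / 2 + c * \<delta> * L\<close> for \<open>A\<close>, where
  \<open>c\<close> is the constant of the previous step.\<close>

primrec gronwall_const :: "real \<Rightarrow> nat \<Rightarrow> real" where
  "gronwall_const L 0 = 1"
| "gronwall_const L (Suc j) = 2 * (1 + L * gronwall_const L j)"

lemma gronwall_const_nonneg: "0 \<le> L \<Longrightarrow> 0 \<le> gronwall_const L j"
  by (induction j) auto

text \<open>Here \<open>G r\<close> stands for the mass of a dominating function on
  \<open>[r, T]\<close>. The induction runs backwards from \<open>T\<close> over the number
  \<open>j\<close> of half units of mass. On a block of mass at most \<open>1/2\<close> the supremum
  \<open>A\<close> of \<open>\<phi>\<close> occurs on the right with factor at most
  \<open>1/2\<close> and can be absorbed, being finite by the bound \<open>B\<close>. The part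
  beyond the block is controlled by the induction hypothesis.\<close>

lemma backward_gronwall:
  fixes G :: "real \<Rightarrow> real" and \<phi> :: "real \<Rightarrow> 's \<Rightarrow> real"
  assumes cont: "continuous_on {a..T} G" and anti: "antimono_on {a..T} G" and GT: "G T = 0"
    and \<phi>: "\<And>s y. 0 \<le> \<phi> s y" "\<And>s y. s \<in> {a..T} \<Longrightarrow> y \<in> Y \<Longrightarrow> \<phi> s y \<le> B"
    and \<delta>: "0 \<le> \<delta>"
    and step: "\<And>r b A A' x. a \<le> r \<Longrightarrow> r \<le> b \<Longrightarrow> b \<le> T \<Longrightarrow> 0 \<le> A \<Longrightarrow> 0 \<le> A' \<Longrightarrow>
      (\<And>s y. s \<in> {r..b} \<Longrightarrow> y \<in> Y \<Longrightarrow> \<phi> s y \<le> A) \<Longrightarrow>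
      (\<And>s y. s \<in> {b..T} \<Longrightarrow> y \<in> Y \<Longrightarrow> \<phi> s y \<le> A') \<Longrightarrow> x \<in> Y \<Longrightarrow>
      \<phi> r x \<le> \<delta> + A * (G r - G b) + A' * G b"
    and sy: "s \<in> {a..T}" "y \<in> Y"
  shows "\<phi> s y \<le> gronwall_const (G a) (nat \<lceil>2 * G a\<rceil>) * \<delta>"
proof -
  have G_le: "G t \<le> G r" if "a \<le> r" "r \<le> t" "t \<le> T" for r t
    using that by (intro monotone_onD[OF anti, of r t, simplified]) auto
  have G0: "0 \<le> G r" if "r \<in> {a..T}" for r using G_le[of r T] GT that by simp
  have "\<phi> r x \<le> gronwall_const (G a) j * \<delta>"
    if "r \<in> {a..T}" "x \<in> Y" "G r \<le> j / 2" for r x j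
    using that
  proof (induction j arbitrary: r x)
    case 0
    then have "G r = 0" using G0[of r] by simp
    \<comment> \<open>No mass is left after \<open>r\<close>, so the crude bound enters with factor
      zero. The \<open>max 0\<close> supplies the nonnegativity that \<open>step\<close>
      requires.\<close>
    have "\<phi> r x \<le> \<delta> + max 0 B * (G r - G T) + max 0 B * G T"
      using 0 \<phi>(2) by (intro step) (auto intro: order_trans[OF \<phi>(2)])
    then show ?case using \<open>G r = 0\<close> GT by simp
  next
    case (Suc j)
    \<comment> \<open>The block ends at \<open>T\<close> if at most half a unit of mass remains.
      Otherwise the intermediate value theorem yields a point at which exactly half a unit has been
      used up.\<close>
    obtain b where b: "b \<in> {r..T}" "G b \<le> j / 2" "G r - G b \<le> 1 / 2"
    proof (cases "G r \<le> 1 / 2")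
      case True
      then show ?thesis using that[of T] GT Suc.prems by simp
    next
      case False
      have "continuous_on {r..T} G" using cont continuous_on_subset Suc.prems by fastforce
      then obtain b where "r \<le> b" "b \<le> T" "G b = G r - 1 / 2"
        using IVT2'[of G T "G r - 1 / 2" r] False GT Suc.prems by auto
      then show ?thesis using that[of b] Suc.prems by (simp add: field_simps)
    qed
    define c where "c = gronwall_const (G a) j"
    have c: "0 \<le> c" unfolding c_def using G0[of a] Suc.prems by (intro gronwall_const_nonneg) auto
    define A where "A = (SUP (s, y) \<in> {r..b} \<times> Y. \<phi> s y)"
    have le_B: "\<phi> s y \<le> B" if "s \<in> {r..b}" "y \<in> Y" for s y
      using that b Suc.prems by (intro \<phi>(2)) auto
    have bdd: "bdd_above ((\<lambda>(s, y). \<phi> s y) ` ({r..b} \<times> Y))"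
      using le_B by (auto intro!: bdd_aboveI[of _ B])
    have le_A: "\<phi> s y \<le> A" if "s \<in> {r..b}" "y \<in> Y" for s y
      unfolding A_def using that by (intro cSUP_upper2[OF bdd, of "(s, y)"]) auto
    have "0 \<le> A" using le_A[of r x] \<phi>(1)[of r x] b Suc.prems by (auto intro: order_trans)
    \<comment> \<open>\<open>step\<close> is applied from every \<open>s\<close> of the block, not
      just from \<open>r\<close>, so that the supremum itself satisfies the inequality.\<close>
    have "A \<le> \<delta> + A / 2 + c * \<delta> * G a"
      unfolding A_def
    proof (rule cSUP_least)
      show "{r..b} \<times> Y \<noteq> {}" using b Suc.prems by auto
      fix p assume "p \<in> {r..b} \<times> Y"
      then obtain s y where p: "p = (s, y)" "s \<in> {r..b}" "y \<in> Y" by auto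
      have "\<phi> s y \<le> \<delta> + A * (G s - G b) + (c * \<delta>) * G b"
      proof (intro step)
        fix s' y' assume "s' \<in> {b..T}" "y' \<in> Y"
        then show "\<phi> s' y' \<le> c * \<delta>"
          unfolding c_def using b Suc.prems G_le[of b s'] by (intro Suc.IH) auto
      qed (use p b Suc.prems le_A c \<delta> \<open>0 \<le> A\<close> in auto)
      moreover have "A * (G s - G b) \<le> A * (1 / 2)"
        using G_le[of r s] b p Suc.prems \<open>0 \<le> A\<close> by (intro mult_left_mono) auto
      moreover have "(c * \<delta>) * G b \<le> (c * \<delta>) * G a"
        using G_le[of a b] b Suc.prems c \<delta> by (intro mult_left_mono) auto
      ultimately show "(case p of (s, y) \<Rightarrow> \<phi> s y)
          \<le> \<delta> + (SUP (s, y)\<in>{r..b} \<times> Y. \<phi> s y) / 2 + c * \<delta> * G a"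
        by (simp add: p A_def)
    qed
    then have "A \<le> gronwall_const (G a) (Suc j) * \<delta>" by (simp add: c_def algebra_simps)
    then show ?case using le_A[of r x] b Suc.prems by auto
  qed
  \<comment> \<open>The number of half units needed to exhaust the mass on the whole
    interval.\<close>
  moreover have "G s \<le> real (nat \<lceil>2 * G a\<rceil>) / 2"
    using G_le[of a s] sy real_nat_ceiling_ge[of "2 * G a"] by simp
  ultimately show ?thesis using sy by blast
qed

subsection \<open>Path integrals\<close>

lemma neighborhood_in_closureE:
  assumes "neighborhood_in (closure D) w W"
  obtains U where "open U" "w \<in> U" "U \<inter> D \<subseteq> W"
  using assms closure_subset[of D] unfolding neighborhood_in_def openin_open by blast

text \<open>For two approximate solutions with values \<open>x\<close>, \<open>y\<close>, expected
  terminal values \<open>a\<close>, \<open>b\<close> and expected driver integrals \<open>c\<close>,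
  \<open>d\<close>, the four terms are the terminal error, the driver error and the two
  residuals.\<close>

lemma norm_triangle_rearrange:
  fixes a b c d x y :: "'a::real_normed_vector"
  shows "norm (x - y) \<le> norm (a - b) + norm (c - d) + (norm (a - x - c) + norm (b - y - d))"
proof -
  have "x - y = ((a - b) - (c - d)) - ((a - x - c) - (b - y - d))" by simp
  also have "norm \<dots> \<le> norm ((a - b) - (c - d)) + norm ((a - x - c) - (b - y - d))"
    by (rule norm_triangle_ineq4)
  also have "\<dots> \<le> (norm (a - b) + norm (c - d)) + (norm (a - x - c) + norm (b - y - d))"
    by (intro add_mono norm_triangle_ineq4)
  finally show ?thesis .
qed

text \<open>Controls how the residual of the equation changes when an approximate solution is
  replaced by its limit.\<close>

lemma norm_triangle_perturb:
  fixes a a' x x' c c' :: "'a::real_normed_vector"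
  shows "norm (a' - x' - c') \<le> norm (a - x - c) + (norm (a - a') + norm (x - x') + norm (c - c'))"
proof -
  have "a' - x' - c' = (a - x - c) - ((a - a') - (x - x') - (c - c'))" by simp
  also have "norm \<dots> \<le> norm (a - x - c) + norm ((a - a') - (x - x') - (c - c'))"
    by (rule norm_triangle_ineq4)
  also have "norm ((a - a') - (x - x') - (c - c')) \<le> norm ((a - a') - (x - x')) + norm (c - c')"
    by (rule norm_triangle_ineq4)
  also have "norm ((a - a') - (x - x')) \<le> norm (a - a') + norm (x - x')"
    by (rule norm_triangle_ineq4)
  finally show ?thesis by simp
qed

section \<open>Standing assumptions and joint measurability of paths\<close>

locale markovian_equation = progressive_markov_process T S d M F X P
  for T :: real and S :: "'s topology" and d and M :: "'w measure" and F X P +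
  fixes \<mu> :: "real measure"
    and D :: "'b::euclidean_space set"
    and f :: "(real \<times> 's) \<times> 'b \<Rightarrow> 'b"
    and I :: "real set"
  assumes S: "metrizable_space S" "separable_space S"
    and d: "pseudometric_on ({0..T} \<times> topspace S) d"
    and d_coarser: "\<And>U. openin (pseudometric_topology ({0..T} \<times> topspace S) d) U \<Longrightarrow>
      openin (prod_topology (top_of_set {0..T}) S) U"
    and sets_mu: "sets \<mu> = sets (restrict_space borel {0..T})"
    and atomless_mu: "atomless \<mu>"
    and f: "f \<in> BC1minus T S d \<mu> D"
    and I: "admissible_interval T I"
begin

lemma I_subset: "I \<subseteq> {0..T}" and T_in_I: "T \<in> I" and T_nonneg: "0 \<le> T"
  using I by (auto simp: admissible_interval_def)

lemma interval_subset_I: "r \<in> I \<Longrightarrow> t \<in> I \<Longrightarrow> {r..t} \<subseteq> I"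
  using I by (auto simp: admissible_interval_def)

lemma space_mu: "space \<mu> = {0..T}"
  using sets_eq_imp_space_eq[OF sets_mu] by simp

lemma interval_in_sets_mu: "{r..t} \<subseteq> {0..T} \<Longrightarrow> {r..t} \<in> sets \<mu>"
  unfolding sets_mu by (auto simp: sets_restrict_space_iff)

lemma ident_measurable_mu: "(\<lambda>s. s) \<in> borel_measurable \<mu>"
  by (subst measurable_cong_sets[OF sets_mu refl]) (intro measurable_restrict_space1, simp)

text \<open>A subset of a singleton is empty or the singleton itself, so a point of positive mass
  would contradict the absence of atoms.\<close>

lemma emeasure_mu_singleton: "emeasure \<mu> {a} = 0"
proof (cases "a \<in> {0..T}")
  case True
  then have "{a} \<in> sets \<mu>" using interval_in_sets_mu[of a a] by auto
  then show ?thesis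
    using atomless_mu unfolding atomless_def
    by (metis emeasure_empty less_irrefl not_gr_zero subset_singletonD)
next
  case False
  \<comment> \<open>Outside \<open>[0,T]\<close> the singleton is not measurable, and
    \<open>emeasure\<close> takes its default value 0 there.\<close>
  then have "{a} \<notin> sets \<mu>" using sets.sets_into_space[of "{a}" \<mu>] space_mu by auto
  then show ?thesis by (rule emeasure_notin_sets)
qed

lemma AE_mu_not_eq: "AE s in \<mu>. s \<noteq> a"
proof (cases "a \<in> {0..T}")
  case True
  then have "{a} \<in> null_sets \<mu>"
    using interval_in_sets_mu[of a a] emeasure_mu_singleton by (intro null_setsI) auto
  then show ?thesis by (rule AE_I') auto
next
  case False
  then show ?thesis by (intro AE_I2) (auto simp: space_mu)
qed

lemma X_in_topspace: "t \<in> {0..T} \<Longrightarrow> \<omega> \<in> space M \<Longrightarrow> X t \<omega> \<in> topspace S"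
  using measurable_space[OF adapted] filtration_subalgebra
  by (fastforce simp: subalgebra_def)

lemma X_measurable: "t \<in> {0..T} \<Longrightarrow> X t \<in> measurable M (borel_of S)"
  using measurable_from_subalg[OF filtration_subalgebra adapted] .

text \<open>This is progressive measurability at time \<open>T\<close>; the natural filtration at
  \<open>T\<close> is contained in the sigma-algebra of \<open>M\<close>.\<close>

lemma X_jointly_measurable: "(\<lambda>z. X (snd z) (fst z)) \<in> measurable (M \<Otimes>\<^sub>M \<mu>) (borel_of S)"
proof -
  let ?G = "generated_sigma (space M) (borel_of S) X {0..T}"
  have "(\<lambda>\<omega>. \<omega>) \<in> measurable M ?G"
    unfolding generated_sigma_def
  proof (rule measurable_measure_of)
    fix A assume "A \<in> {X s -` B \<inter> space M |s B. s \<in> {0..T} \<and> B \<in> sets (borel_of S)}"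
    then show "(\<lambda>\<omega>. \<omega>) -` A \<inter> space M \<in> sets M"
      using measurable_sets[OF X_measurable] by (auto simp: Int_absorb2 Int_assoc)
  qed auto
  then have id: "(\<lambda>z. fst z) \<in> measurable (M \<Otimes>\<^sub>M \<mu>) ?G"
    using measurable_compose[OF measurable_fst, of "\<lambda>\<omega>. \<omega>" M ?G \<mu>] by simp
  have "(\<lambda>s. s) \<in> measurable \<mu> (restrict_space borel {0..T})"
    by (subst measurable_cong_sets[OF sets_mu refl]) simp
  then have "(\<lambda>z. snd z) \<in> measurable (M \<Otimes>\<^sub>M \<mu>) (restrict_space borel {0..T})"
    using measurable_compose[OF measurable_snd, of "\<lambda>s. s" \<mu> _ M] by simp
  from measurable_compose[OF measurable_Pair[OF this id] progressive[of T]]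
  show ?thesis using T_nonneg by simp
qed

lemma slice_measurable:
  assumes J: "J \<subseteq> {0..T}" "t \<in> J" and \<Phi>: "\<Phi> \<in> measurable (time_borel S d J) N"
  shows "(\<lambda>\<omega>. \<Phi> (t, X t \<omega>)) \<in> measurable M N"
proof -
  have "(\<lambda>\<omega>. (t, X t \<omega>)) \<in> measurable M (time_borel S d J)"
    using J X_measurable[of t] by (intro measurable_time_borel[OF S d d_coarser]) auto
  from measurable_compose[OF this \<Phi>] show ?thesis .
qed

text \<open>Since \<open>\<Phi>\<close> is measurable on \<open>J\<close> only, the composition is
  first formed on the strip where the time lies in \<open>{r..t}\<close> and then extended by zero
  through the indicator.\<close>

lemma path_jointly_measurable:
  fixes \<Phi> :: "real \<times> 's \<Rightarrow> 'c::{banach, second_countable_topology}"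
  assumes J: "J \<subseteq> {0..T}" "{r..t} \<subseteq> J" and \<Phi>: "\<Phi> \<in> borel_measurable (time_borel S d J)"
  shows "(\<lambda>z. indicator {r..t} (snd z) *\<^sub>R \<Phi> (snd z, X (snd z) (fst z)))
    \<in> borel_measurable (M \<Otimes>\<^sub>M \<mu>)"
proof -
  let ?\<Omega> = "{z :: 'w \<times> real. snd z \<in> {r..t}}"
  have "?\<Omega> \<inter> space (M \<Otimes>\<^sub>M \<mu>) = space M \<times> {r..t}"
    using J by (auto simp: space_pair_measure space_mu)
  moreover have "{r..t} \<in> sets \<mu>" using J by (intro interval_in_sets_mu) blast
  ultimately have \<Omega>: "?\<Omega> \<inter> space (M \<Otimes>\<^sub>M \<mu>) \<in> sets (M \<Otimes>\<^sub>M \<mu>)" by simp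
  have "(\<lambda>z. (snd z, X (snd z) (fst z)))
      \<in> measurable (restrict_space (M \<Otimes>\<^sub>M \<mu>) ?\<Omega>) (time_borel S d J)"
  proof (intro measurable_time_borel[OF S d d_coarser])
    show "(\<lambda>z. snd z) \<in> borel_measurable (restrict_space (M \<Otimes>\<^sub>M \<mu>) ?\<Omega>)"
      using measurable_compose[OF measurable_snd ident_measurable_mu]
      by (intro measurable_restrict_space1)
    show "(\<lambda>z. X (snd z) (fst z)) \<in> measurable (restrict_space (M \<Otimes>\<^sub>M \<mu>) ?\<Omega>) (borel_of S)"
      by (intro measurable_restrict_space1 X_jointly_measurable)
  qed (use J in \<open>auto simp: space_restrict_space\<close>)
  from measurable_compose[OF this \<Phi>]
  have "(\<lambda>z. indicator ?\<Omega> z *\<^sub>R \<Phi> (snd z, X (snd z) (fst z))) \<in> borel_measurable (M \<Otimes>\<^sub>M \<mu>)"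
    using borel_measurable_restrict_space_iff[OF \<Omega>, of "\<lambda>z. \<Phi> (snd z, X (snd z) (fst z))"]
    by simp
  then show ?thesis by (simp add: indicator_def)
qed

section \<open>Path integrals under a dominating function of time only\<close>

context
  fixes \<Phi> :: "real \<times> 's \<Rightarrow> 'c::{banach, second_countable_topology}" and l J r t
  assumes J: "J \<subseteq> {0..T}" "{r..t} \<subseteq> J" and \<Phi>: "\<Phi> \<in> borel_measurable (time_borel S d J)"
    and l: "integrable \<mu> l" "\<And>s. 0 \<le> l s"
    and bound: "AE s in \<mu>. s \<in> {r..t} \<longrightarrow> (\<forall>y\<in>topspace S. norm (\<Phi> (s, y)) \<le> l s)"
begin

lemma path_AE_bound:
  assumes "\<omega> \<in> space M"
  shows "AE s in \<mu>. norm (indicator {r..t} s *\<^sub>R \<Phi> (s, X s \<omega>)) \<le> indicator {r..t} s * l s"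
  using bound AE_space
proof eventually_elim
  case (elim s)
  then show ?case using X_in_topspace[of s \<omega>] assms by (auto simp: space_mu indicator_def)
qed

text \<open>The exceptional null set of \<open>bound\<close> does not depend on the state, so the
  domination holds along every path and not merely almost surely.\<close>

lemma path_set_integrable:
  assumes "\<omega> \<in> space M"
  shows "set_integrable \<mu> {r..t} (\<lambda>s. \<Phi> (s, X s \<omega>))"
  unfolding set_integrable_def
proof (rule Bochner_Integration.integrable_bound[OF l(1)])
  show "(\<lambda>s. indicator {r..t} s *\<^sub>R \<Phi> (s, X s \<omega>)) \<in> borel_measurable \<mu>"
    using measurable_compose[OF measurable_Pair1'[OF assms] path_jointly_measurable[OF J \<Phi>]]
    by simp
  show "AE s in \<mu>. norm (indicator {r..t} s *\<^sub>R \<Phi> (s, X s \<omega>)) \<le> norm (l s)"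
    using path_AE_bound[OF assms]
  proof eventually_elim
    case (elim s)
    then show ?case using l(2)[of s] by (auto simp: indicator_def split: if_splits)
  qed
qed

lemma path_integral_norm_le:
  assumes "\<omega> \<in> space M"
  shows "norm (LINT s:{r..t}|\<mu>. \<Phi> (s, X s \<omega>)) \<le> (LINT s:{r..t}|\<mu>. l s)"
proof -
  have "norm (LINT s:{r..t}|\<mu>. \<Phi> (s, X s \<omega>))
      \<le> (\<integral>s. norm (indicator {r..t} s *\<^sub>R \<Phi> (s, X s \<omega>)) \<partial>\<mu>)"
    unfolding set_lebesgue_integral_def by (rule integral_norm_bound)
  also have "\<dots> \<le> (LINT s:{r..t}|\<mu>. l s)"
    unfolding set_lebesgue_integral_def
  proof (rule integral_mono_AE)
    show "integrable \<mu> (\<lambda>s. norm (indicator {r..t} s *\<^sub>R \<Phi> (s, X s \<omega>)))"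
      using path_set_integrable[OF assms] unfolding set_integrable_def by (rule integrable_norm)
    show "integrable \<mu> (\<lambda>s. indicator {r..t} s *\<^sub>R l s)"
      using J by (intro integrable_mult_indicator interval_in_sets_mu l) blast
  qed (use path_AE_bound[OF assms] in simp)
  finally show ?thesis .
qed

text \<open>\<open>\<mu>\<close> need not be \<open>\<sigma>\<close>-finite, so parameter integrals are taken against the finite
  measure with density \<open>l\<close>.\<close>

lemma path_integral_measurable:
  "(\<lambda>\<omega>. LINT s:{r..t}|\<mu>. \<Phi> (s, X s \<omega>)) \<in> borel_measurable M"
proof -
  define \<nu> where "\<nu> = density \<mu> l"
  have lm: "l \<in> borel_measurable \<mu>" using l(1) by auto
  have "emeasure \<nu> (space \<nu>) = (\<integral>\<^sup>+ s. ennreal (l s) \<partial>\<mu>)"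
    unfolding \<nu>_def using lm by (subst emeasure_density) (auto intro!: nn_integral_cong)
  also have "\<dots> = ennreal (\<integral>s. l s \<partial>\<mu>)" using l by (intro nn_integral_eq_integral) auto
  finally have "emeasure \<nu> (space \<nu>) \<noteq> \<infinity>" by simp
  then interpret \<nu>: finite_measure \<nu> by (rule finite_measureI)
  \<comment> \<open>Division by zero gives 0. Where \<open>l\<close> vanishes, the domination forces
    the integrand to vanish as well for almost every such time, so multiplying \<open>?h\<close> by
    \<open>l\<close> recovers the integrand almost everywhere.\<close>
  let ?h = "\<lambda>\<omega> s. (1 / l s) *\<^sub>R (indicator {r..t} s *\<^sub>R \<Phi> (s, X s \<omega>))"
  have sets\<nu>: "sets \<nu> = sets \<mu>" by (simp add: \<nu>_def)
  have h: "(\<lambda>z. ?h (fst z) (snd z)) \<in> borel_measurable (M \<Otimes>\<^sub>M \<mu>)"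
    by (intro borel_measurable_scaleR path_jointly_measurable[OF J \<Phi>] borel_measurable_divide
        borel_measurable_const measurable_compose[OF measurable_snd lm])
  also have "borel_measurable (M \<Otimes>\<^sub>M \<mu>) = borel_measurable (M \<Otimes>\<^sub>M \<nu>)"
    by (intro measurable_cong_sets sets_pair_measure_cong) (simp_all add: sets\<nu>)
  finally have "case_prod ?h \<in> borel_measurable (M \<Otimes>\<^sub>M \<nu>)" by (simp add: case_prod_beta')
  then have "(\<lambda>\<omega>. \<integral>s. ?h \<omega> s \<partial>\<nu>) \<in> borel_measurable M" by (rule \<nu>.borel_measurable_lebesgue_integral)
  moreover have "(\<integral>s. ?h \<omega> s \<partial>\<nu>) = (LINT s:{r..t}|\<mu>. \<Phi> (s, X s \<omega>))" if \<omega>: "\<omega> \<in> space M" for \<omega>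
  proof -
    have hm: "?h \<omega> \<in> borel_measurable \<mu>"
      using measurable_compose[OF measurable_Pair1'[OF \<omega>] h] by simp
    have "(\<integral>s. ?h \<omega> s \<partial>\<nu>) = (\<integral>s. l s *\<^sub>R ?h \<omega> s \<partial>\<mu>)"
      unfolding \<nu>_def using l(2) by (intro integral_density[OF hm lm]) simp
    also have "\<dots> = (\<integral>s. indicator {r..t} s *\<^sub>R \<Phi> (s, X s \<omega>) \<partial>\<mu>)"
    proof (rule integral_cong_AE)
      show "(\<lambda>s. l s *\<^sub>R ?h \<omega> s) \<in> borel_measurable \<mu>"
        by (rule borel_measurable_scaleR[OF lm hm])
      show "(\<lambda>s. indicator {r..t} s *\<^sub>R \<Phi> (s, X s \<omega>)) \<in> borel_measurable \<mu>"
        using path_set_integrable[OF \<omega>] unfolding set_integrable_def by auto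
      show "AE s in \<mu>. l s *\<^sub>R ?h \<omega> s = indicator {r..t} s *\<^sub>R \<Phi> (s, X s \<omega>)"
        using path_AE_bound[OF \<omega>]
        by eventually_elim (use l(2) in \<open>auto simp: indicator_def split: if_splits\<close>)
    qed
    finally show ?thesis by (simp add: set_lebesgue_integral_def)
  qed
  ultimately show ?thesis by (subst measurable_cong[symmetric]) auto
qed

end

text \<open>Dominated convergence: when \<open>v n\<close> tends to \<open>a\<close>, the indicators
  converge at every \<open>s\<close> other than \<open>a\<close>, and the single point
  \<open>a\<close> has no mass.\<close>

lemma continuous_on_tail_integral:
  assumes l: "integrable \<mu> l"
  shows "continuous_on {0..T} (\<lambda>r. LINT s:{r..T}|\<mu>. l s :: real)"
proof (rule continuous_on_sequentiallyI)
  fix v a assume v: "\<forall>n. v n \<in> {0..T}" "a \<in> {0..T}" "v \<longlonglongrightarrow> a"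
  show "(\<lambda>n. LINT s:{v n..T}|\<mu>. l s) \<longlonglongrightarrow> (LINT s:{a..T}|\<mu>. l s)"
    unfolding set_lebesgue_integral_def
  proof (rule integral_dominated_convergence[where w = "\<lambda>s. norm (l s)"])
    have *: "(\<lambda>s. indicator {b..T} s *\<^sub>R l s) \<in> borel_measurable \<mu>" if "b \<in> {0..T}" for b
      using integrable_mult_indicator[OF interval_in_sets_mu l, of b T] that by auto
    show "(\<lambda>s. indicator {a..T} s *\<^sub>R l s) \<in> borel_measurable \<mu>"
      "(\<lambda>s. indicator {v n..T} s *\<^sub>R l s) \<in> borel_measurable \<mu>" for n
      using * v by auto
    show "integrable \<mu> (\<lambda>s. norm (l s))" using l by simp
    show "AE s in \<mu>. norm (indicator {v n..T} s *\<^sub>R l s) \<le> norm (l s)" for n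
      by (simp add: indicator_def)
    show "AE s in \<mu>. (\<lambda>n. indicator {v n..T} s *\<^sub>R l s) \<longlonglongrightarrow> indicator {a..T} s *\<^sub>R l s"
      using AE_mu_not_eq[of a]
    proof eventually_elim
      case (elim s)
      have "\<forall>\<^sub>F n in sequentially. indicator {v n..T} s = (indicator {a..T} s :: real)"
      proof (cases "s < a")
        case True
        from order_tendstoD(1)[OF v(3) this] show ?thesis
          by eventually_elim (use True in \<open>auto simp: indicator_def\<close>)
      next
        case False
        with elim have "a < s" by simp
        from order_tendstoD(2)[OF v(3) this] show ?thesis
          by eventually_elim (use \<open>a < s\<close> in \<open>auto simp: indicator_def\<close>)
      qed
      then show ?case by (intro tendsto_eventually) (auto elim: eventually_mono)
    qed
  qed
qed

subsection \<open>Regularity on compact sets\<close>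

text \<open>Taking the absolute value makes the dominating function nonnegative on the whole real
  line, not just on \<open>[0,T]\<close>.\<close>

lemma mu_dominatedE:
  assumes "mu_dominated T S d \<mu> a"
  obtains b where "integrable \<mu> b" "\<And>s. 0 \<le> b s" "AE s in \<mu>. \<forall>y\<in>topspace S. a (s, y) \<le> b s"
proof -
  obtain a' where a': "integrable \<mu> a'" "AE s in \<mu>. \<forall>y\<in>topspace S. a (s, y) \<le> a' s"
    using assms unfolding mu_dominated_def by blast
  show ?thesis
  proof (rule that[of "\<lambda>s. \<bar>a' s\<bar>"])
    show "AE s in \<mu>. \<forall>y\<in>topspace S. a (s, y) \<le> \<bar>a' s\<bar>"
      using a'(2) by eventually_elim (meson abs_ge_self order_trans)
  qed (use a' in auto)
qed

text \<open>The quantifiers over states and values stand inside the almost-everywhere statement. One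
  null set therefore serves all of them, and \<open>l\<close> can be used along arbitrary
  paths.\<close>

definition regular_on :: "'b set \<Rightarrow> (real \<Rightarrow> real) \<Rightarrow> bool" where
  "regular_on K l \<longleftrightarrow> integrable \<mu> l \<and> (\<forall>s. 0 \<le> l s) \<and>
     (AE s in \<mu>. \<forall>y\<in>topspace S. \<forall>v\<in>K. norm (f ((s, y), v)) \<le> l s \<and>
        (\<forall>v'\<in>K. norm (f ((s, y), v) - f ((s, y), v')) \<le> l s * norm (v - v')))"

text \<open>Boundedness and Lipschitz continuity come with different neighborhoods and dominating
  functions; the intersection and the sum serve both.\<close>

lemma local_regularity:
  assumes w: "w \<in> D"
  shows "\<exists>U a. open U \<and> w \<in> U \<and> regular_on (U \<inter> D) a"
proof -
  obtain W1 l1 where 1: "neighborhood_in (closure D) w W1" "mu_dominated T S d \<mu> l1"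
    "\<And>p v. p \<in> {0..T} \<times> topspace S \<Longrightarrow> v \<in> W1 \<inter> D \<Longrightarrow> norm (f (p, v)) \<le> l1 p"
    using f w unfolding BC1minus_def locally_mu_bounded_def by blast
  obtain W2 l2 where 2: "neighborhood_in (closure D) w W2" "mu_dominated T S d \<mu> l2"
    "\<And>p v v'. p \<in> {0..T} \<times> topspace S \<Longrightarrow> v \<in> W2 \<inter> D \<Longrightarrow> v' \<in> W2 \<inter> D \<Longrightarrow>
      norm (f (p, v) - f (p, v')) \<le> l2 p * norm (v - v')"
    using f w unfolding BC1minus_def locally_Lipschitz_mu_continuous_def by blast
  obtain U1 where U1: "open U1" "w \<in> U1" "U1 \<inter> D \<subseteq> W1" using neighborhood_in_closureE[OF 1(1)] .
  obtain U2 where U2: "open U2" "w \<in> U2" "U2 \<inter> D \<subseteq> W2" using neighborhood_in_closureE[OF 2(1)] .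
  obtain a1 where a1: "integrable \<mu> a1" "\<And>s. 0 \<le> a1 s" "AE s in \<mu>. \<forall>y\<in>topspace S. l1 (s, y) \<le> a1 s"
    by (rule mu_dominatedE[OF 1(2)]) (rule that)
  obtain a2 where a2: "integrable \<mu> a2" "\<And>s. 0 \<le> a2 s" "AE s in \<mu>. \<forall>y\<in>topspace S. l2 (s, y) \<le> a2 s"
    by (rule mu_dominatedE[OF 2(2)]) (rule that)
  have "regular_on (U1 \<inter> U2 \<inter> D) (\<lambda>s. a1 s + a2 s)"
    unfolding regular_on_def
  proof (intro conjI allI)
    show "AE s in \<mu>. \<forall>y\<in>topspace S. \<forall>v\<in>U1 \<inter> U2 \<inter> D. norm (f ((s, y), v)) \<le> a1 s + a2 s \<and>
      (\<forall>v'\<in>U1 \<inter> U2 \<inter> D. norm (f ((s, y), v) - f ((s, y), v')) \<le> (a1 s + a2 s) * norm (v - v'))"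
      using a1(3) a2(3) AE_space
    proof eventually_elim
      case (elim s)
      show ?case
      proof (intro ballI conjI)
        fix y v assume yv: "y \<in> topspace S" "v \<in> U1 \<inter> U2 \<inter> D"
        have "norm (f ((s, y), v)) \<le> l1 (s, y)" using yv elim U1 by (intro 1) (auto simp: space_mu)
        also have "\<dots> \<le> a1 s" using elim yv by blast
        finally show "norm (f ((s, y), v)) \<le> a1 s + a2 s" using a2(2)[of s] by simp
        fix v' assume v': "v' \<in> U1 \<inter> U2 \<inter> D"
        have "norm (f ((s, y), v) - f ((s, y), v')) \<le> l2 (s, y) * norm (v - v')"
          using yv v' elim U2 by (intro 2) (auto simp: space_mu)
        also have "\<dots> \<le> (a1 s + a2 s) * norm (v - v')"
          using elim yv a1(2)[of s] by (intro mult_right_mono) (auto intro: add_increasing)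
        finally show "norm (f ((s, y), v) - f ((s, y), v')) \<le> (a1 s + a2 s) * norm (v - v')" .
      qed
    qed
  qed (use a1 a2 in auto)
  then show ?thesis using U1 U2 by (intro exI[of _ "U1 \<inter> U2"]) auto
qed

text \<open>A finite subcover of \<open>K\<close> gives the common bound \<open>b\<close>, a finite
  sum. Local Lipschitz estimates become an estimate on all of \<open>K\<close> by a Lebesgue number
  \<open>e\<close>: points closer than \<open>e\<close> share one neighborhood, and for the others
  the increment of \<open>f\<close> is at most \<open>2 * b s\<close>, hence at most
  \<open>2 * b s / e\<close> times their distance. This explains the factor
  \<open>1 + 2 / e\<close>.\<close>

lemma compact_regularity:
  assumes K: "compact K" "K \<subseteq> D"
  obtains l where "regular_on K l"
proof -
  obtain U a where Ua: "\<And>w. w \<in> D \<Longrightarrow> open (U w)" "\<And>w. w \<in> D \<Longrightarrow> w \<in> U w"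
    "\<And>w. w \<in> D \<Longrightarrow> regular_on (U w \<inter> D) (a w)"
    using local_regularity by metis
  have "\<And>w. w \<in> K \<Longrightarrow> open (U w)" "K \<subseteq> (\<Union>w\<in>K. U w)" using Ua(1,2) K(2) by blast+
  from compactE_image[OF K(1) this] obtain C
    where C: "C \<subseteq> K" "finite C" "K \<subseteq> (\<Union>w\<in>C. U w)" .
  have CD: "w \<in> D" if "w \<in> C" for w using that C K by auto
  have "K \<subseteq> \<Union>(U ` C)" "\<And>G. G \<in> U ` C \<Longrightarrow> open G" using C(3) Ua(1) CD by auto
  \<comment> \<open>\<open>e\<close> is a Lebesgue number of the finite cover.\<close>
  from Heine_Borel_lemma[OF K(1) this] obtain e
    where e: "e > 0" "\<And>v. v \<in> K \<Longrightarrow> \<exists>G\<in>U ` C. ball v e \<subseteq> G" by metis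
  have a: "integrable \<mu> (a w)" "0 \<le> a w s"
    "AE s in \<mu>. \<forall>y\<in>topspace S. \<forall>v\<in>U w \<inter> D. norm (f ((s, y), v)) \<le> a w s \<and>
      (\<forall>v'\<in>U w \<inter> D. norm (f ((s, y), v) - f ((s, y), v')) \<le> a w s * norm (v - v'))"
    if "w \<in> C" for w s
    using Ua(3)[OF CD[OF that]] unfolding regular_on_def by auto
  define b where "b s = (\<Sum>w\<in>C. a w s)" for s
  have b0: "0 \<le> b s" for s unfolding b_def using a(2) by (intro sum_nonneg) auto
  have ab: "a w s \<le> b s" if "w \<in> C" for w s
    unfolding b_def using a(2) C(2) that by (intro member_le_sum) auto
  have "regular_on K (\<lambda>s. b s * (1 + 2 / e))"
    unfolding regular_on_def
  proof (intro conjI allI)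
    show "integrable \<mu> (\<lambda>s. b s * (1 + 2 / e))"
      unfolding b_def using a(1) by (intro integrable_mult_left Bochner_Integration.integrable_sum) auto
    show "0 \<le> b s * (1 + 2 / e)" for s using b0 e by simp
    have "AE s in \<mu>. \<forall>w\<in>C. \<forall>y\<in>topspace S. \<forall>v\<in>U w \<inter> D. norm (f ((s, y), v)) \<le> a w s \<and>
      (\<forall>v'\<in>U w \<inter> D. norm (f ((s, y), v) - f ((s, y), v')) \<le> a w s * norm (v - v'))"
      by (intro AE_finite_allI C(2) a(3))
    then show "AE s in \<mu>. \<forall>y\<in>topspace S. \<forall>v\<in>K. norm (f ((s, y), v)) \<le> b s * (1 + 2 / e) \<and>
      (\<forall>v'\<in>K. norm (f ((s, y), v) - f ((s, y), v')) \<le> b s * (1 + 2 / e) * norm (v - v'))"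
    proof eventually_elim
      case (elim s)
      have fb: "norm (f ((s, y), v)) \<le> b s" if yv: "y \<in> topspace S" "v \<in> K" for y v
      proof -
        obtain w where "w \<in> C" "v \<in> U w" using C(3) yv by blast
        then have "norm (f ((s, y), v)) \<le> a w s" using elim yv K(2) by blast
        then show ?thesis using ab[OF \<open>w \<in> C\<close>, of s] by simp
      qed
      have bb: "b s \<le> b s * (1 + 2 / e)" using b0[of s] e(1) by (simp add: algebra_simps)
      show ?case
      proof (intro ballI conjI)
        fix y v assume yv: "y \<in> topspace S" "v \<in> K"
        show "norm (f ((s, y), v)) \<le> b s * (1 + 2 / e)" using fb[OF yv] bb by simp
        fix v' assume v': "v' \<in> K"
        show "norm (f ((s, y), v) - f ((s, y), v')) \<le> b s * (1 + 2 / e) * norm (v - v')"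
        proof (cases "norm (v - v') < e")
          case True
          obtain w where w: "w \<in> C" "ball v e \<subseteq> U w" using e(2)[OF yv(2)] by blast
          have "v' \<in> ball v e" using True by (simp add: dist_norm)
          moreover have "v \<in> ball v e" using e(1) by simp
          ultimately have "v \<in> U w \<inter> D" "v' \<in> U w \<inter> D" using w yv v' K(2) by auto
          then have "norm (f ((s, y), v) - f ((s, y), v')) \<le> a w s * norm (v - v')"
            using elim w yv by blast
          also have "\<dots> \<le> b s * (1 + 2 / e) * norm (v - v')"
            using ab[OF w(1), of s] bb by (intro mult_right_mono) auto
          finally show ?thesis .
        next
          case False
          have "norm (f ((s, y), v) - f ((s, y), v')) \<le> b s + b s"
            using norm_triangle_ineq4[of "f ((s, y), v)" "f ((s, y), v')"] fb[OF yv] fb[OF yv(1) v']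
            by linarith
          also have "\<dots> \<le> b s * (2 / e) * e" using e(1) by simp
          also have "\<dots> \<le> b s * (1 + 2 / e) * norm (v - v')"
            using False b0[of s] e(1) by (intro mult_mono mult_left_mono) auto
          finally show ?thesis .
        qed
      qed
    qed
  qed
  then show ?thesis by (rule that)
qed

subsection \<open>Stability of approximate solutions\<close>

abbreviation approx_sol where
  "approx_sol g \<epsilon> u \<equiv> approx_solution T S d M X P \<mu> D f g \<epsilon> I u"

abbreviation tail :: "(real \<Rightarrow> real) \<Rightarrow> real \<Rightarrow> real" where
  "tail l r \<equiv> LINT s:{r..T}|\<mu>. l s"

definition values_in :: "'b set \<Rightarrow> real \<Rightarrow> (real \<times> 's \<Rightarrow> 'b) \<Rightarrow> bool" where
  "values_in K r u \<longleftrightarrow> (AE s in \<mu>. s \<in> {r..T} \<longrightarrow> (\<forall>y\<in>topspace S. u (s, y) \<in> K))"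

lemma approx_solD:
  assumes "approx_sol g \<epsilon> u"
  shows "u \<in> measurable (time_borel S d I) (restrict_space borel D)"
    and "consistent_on S d I u"
    and "x \<in> topspace S \<Longrightarrow> u (T, x) = g x"
    and "r \<in> I \<Longrightarrow> t \<in> I \<Longrightarrow> r \<le> t \<Longrightarrow> x \<in> topspace S \<Longrightarrow>
      integrable (P (r, x)) (\<lambda>\<omega>. norm (u (t, X t \<omega>)))"
    and "r \<in> I \<Longrightarrow> t \<in> I \<Longrightarrow> r \<le> t \<Longrightarrow> x \<in> topspace S \<Longrightarrow>
      norm ((LINT \<omega>|P (r, x). u (t, X t \<omega>)) - u (r, x)
            - (LINT \<omega>|P (r, x). (LINT s:{r..t}|\<mu>. f ((s, X s \<omega>), u (s, X s \<omega>)))))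
      \<le> (LINT \<omega>|P (r, x). (LINT s:{r..t}|\<mu>. \<epsilon> (s, X s \<omega>)))"
  using assms unfolding approx_solution_def by blast+

lemma borel_measurable_of_D:
  "u \<in> measurable N (restrict_space borel D) \<Longrightarrow> u \<in> borel_measurable N"
  using measurable_restrict_space2_iff by blast

lemma space_P: "p \<in> {0..T} \<times> topspace S \<Longrightarrow> space (P p) = space M"
  by (rule sets_eq_imp_space_eq[OF sets_P])

lemma measurable_P: "p \<in> {0..T} \<times> topspace S \<Longrightarrow> measurable (P p) N = measurable M N"
  by (rule measurable_cong_sets[OF sets_P refl])

lemma expectation_bound:
  fixes h :: "'w \<Rightarrow> 'c::{banach, second_countable_topology}"
  assumes p: "p \<in> {0..T} \<times> topspace S" and h: "h \<in> borel_measurable M"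
    and le: "\<And>\<omega>. \<omega> \<in> space M \<Longrightarrow> norm (h \<omega>) \<le> c"
  shows "integrable (P p) h" and "norm (\<integral>\<omega>. h \<omega> \<partial>P p) \<le> c"
proof -
  interpret prob_space "P p" by (rule prob[OF p])
  have AE: "AE \<omega> in P p. norm (h \<omega>) \<le> c" by (rule AE_I2) (simp add: space_P[OF p] le)
  show int: "integrable (P p) h"
    by (rule integrable_const_bound[OF AE]) (simp add: measurable_P[OF p] h)
  have "norm (\<integral>\<omega>. h \<omega> \<partial>P p) \<le> (\<integral>\<omega>. norm (h \<omega>) \<partial>P p)" by (rule integral_norm_bound)
  also have "\<dots> \<le> c" using int AE by (intro integral_le_const) auto
  finally show "norm (\<integral>\<omega>. h \<omega> \<partial>P p) \<le> c" .
qed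

lemma integrable_value:
  assumes u: "approx_sol g \<epsilon> u" and "r \<in> I" "t \<in> I" "r \<le> t" "x \<in> topspace S"
  shows "integrable (P (r, x)) (\<lambda>\<omega>. u (t, X t \<omega>))"
proof -
  have "(\<lambda>\<omega>. u (t, X t \<omega>)) \<in> borel_measurable M"
    using slice_measurable[OF I_subset \<open>t \<in> I\<close>] borel_measurable_of_D[OF approx_solD(1)[OF u]] .
  then have "(\<lambda>\<omega>. u (t, X t \<omega>)) \<in> borel_measurable (P (r, x))"
    using assms I_subset by (subst measurable_P) auto
  then show ?thesis using approx_solD(4)[OF assms] by (simp add: integrable_norm_iff)
qed

text \<open>As \<open>\<epsilon>\<close> is nonnegative, its path integral over
  \<open>{r..t}\<close> is at most the one over \<open>{0..T}\<close>, hence at most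
  \<open>e\<close> for every path. Domination of \<open>\<epsilon>\<close> supplies the
  integrability that this comparison needs. The result replaces the error function by a single
  constant.\<close>

lemma residual_bound:
  assumes u: "approx_sol g \<epsilon> u" and \<epsilon>: "mu_dominated T S d \<mu> \<epsilon>"
    and e: "\<And>\<omega>. \<omega> \<in> space M \<Longrightarrow> (LINT s:{0..T}|\<mu>. \<epsilon> (s, X s \<omega>)) \<le> e"
    and rt: "r \<in> I" "t \<in> I" "r \<le> t" and x: "x \<in> topspace S"
  shows "norm ((LINT \<omega>|P (r, x). u (t, X t \<omega>)) - u (r, x)
      - (LINT \<omega>|P (r, x). (LINT s:{r..t}|\<mu>. f ((s, X s \<omega>), u (s, X s \<omega>))))) \<le> e"
proof -
  have rt': "{r..t} \<subseteq> {0..T}" using rt I_subset by auto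
  obtain b where b: "integrable \<mu> b" "\<And>s. 0 \<le> b s" "AE s in \<mu>. \<forall>y\<in>topspace S. \<epsilon> (s, y) \<le> b s"
    by (rule mu_dominatedE[OF \<epsilon>]) (rule that)
  have \<epsilon>m: "\<epsilon> \<in> measurable (time_borel S d {0..T}) (restrict_space borel {0..})"
    using \<epsilon> by (simp add: mu_dominated_def)
  then have \<epsilon>b: "\<epsilon> \<in> borel_measurable (time_borel S d {0..T})"
    using measurable_restrict_space2_iff by blast
  have \<epsilon>0: "0 \<le> \<epsilon> (s, y)" if "s \<in> {0..T}" "y \<in> topspace S" for s y
    using measurable_space[OF \<epsilon>m, of "(s, y)"] that by (auto simp: space_restrict_space)
  have bound: "AE s in \<mu>. s \<in> {r'..t'} \<longrightarrow> (\<forall>y\<in>topspace S. norm (\<epsilon> (s, y)) \<le> b s)" for r' t'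
    using b(3) AE_space
    by eventually_elim (use \<epsilon>0 in \<open>auto simp: space_mu\<close>)
  note path = path_set_integrable[OF order_refl _ \<epsilon>b b(1,2) bound]
  have nonneg: "0 \<le> (LINT s:{r..t}|\<mu>. \<epsilon> (s, X s \<omega>))" if "\<omega> \<in> space M" for \<omega>
    unfolding set_lebesgue_integral_def
    by (intro integral_nonneg_AE AE_I2) (use that rt' \<epsilon>0 X_in_topspace in \<open>auto simp: indicator_def\<close>)
  have le: "(LINT s:{r..t}|\<mu>. \<epsilon> (s, X s \<omega>)) \<le> e" if \<omega>: "\<omega> \<in> space M" for \<omega>
  proof -
    have "(LINT s:{r..t}|\<mu>. \<epsilon> (s, X s \<omega>)) \<le> (LINT s:{0..T}|\<mu>. \<epsilon> (s, X s \<omega>))"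
      unfolding set_lebesgue_integral_def
    proof (rule integral_mono)
      show "integrable \<mu> (\<lambda>s. indicator {r..t} s *\<^sub>R \<epsilon> (s, X s \<omega>))"
        "integrable \<mu> (\<lambda>s. indicator {0..T} s *\<^sub>R \<epsilon> (s, X s \<omega>))"
        using path[OF rt' \<omega>] path[OF order_refl \<omega>] by (auto simp: set_integrable_def)
      show "indicator {r..t} s *\<^sub>R \<epsilon> (s, X s \<omega>) \<le> indicator {0..T} s *\<^sub>R \<epsilon> (s, X s \<omega>)"
        if "s \<in> space \<mu>" for s
        using that \<epsilon>0[OF _ X_in_topspace[OF _ \<omega>], of s s] rt' by (auto simp: space_mu indicator_def)
    qed
    also have "\<dots> \<le> e" by (rule e[OF \<omega>])
    finally show ?thesis .
  qed
  have "norm (LINT \<omega>|P (r, x). (LINT s:{r..t}|\<mu>. \<epsilon> (s, X s \<omega>))) \<le> e"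
  proof (rule expectation_bound(2))
    show "(r, x) \<in> {0..T} \<times> topspace S" using rt x I_subset by auto
    show "(\<lambda>\<omega>. LINT s:{r..t}|\<mu>. \<epsilon> (s, X s \<omega>)) \<in> borel_measurable M"
      by (rule path_integral_measurable[OF order_refl rt' \<epsilon>b b(1,2) bound])
    show "norm (LINT s:{r..t}|\<mu>. \<epsilon> (s, X s \<omega>)) \<le> e" if "\<omega> \<in> space M" for \<omega>
      using le[OF that] nonneg[OF that] by simp
  qed
  then show ?thesis using approx_solD(5)[OF u rt x] by (simp add: abs_le_iff)
qed

section \<open>The driver evaluated along an approximate solution\<close>

lemma driver_measurable:
  assumes "u \<in> measurable (time_borel S d I) (restrict_space borel D)"
  shows "(\<lambda>p. f (p, u p)) \<in> borel_measurable (time_borel S d I)"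
proof -
  have "f \<in> borel_measurable (time_borel S d {0..T} \<Otimes>\<^sub>M restrict_space borel D)"
    using f by (simp add: BC1minus_def)
  from measurable_compose[OF measurable_Pair[OF measurable_ident_time_borel[OF I_subset] assms] this]
  show ?thesis .
qed

lemma driver_bound:
  assumes "regular_on K l" "values_in K r\<^sub>0 u" "r\<^sub>0 \<le> r" "t \<le> T"
  shows "AE s in \<mu>. s \<in> {r..t} \<longrightarrow> (\<forall>y\<in>topspace S. norm (f ((s, y), u (s, y))) \<le> l s)"
proof -
  have "AE s in \<mu>. \<forall>y\<in>topspace S. \<forall>v\<in>K. norm (f ((s, y), v)) \<le> l s"
    using assms(1) unfolding regular_on_def by (auto elim: eventually_mono)
  with assms(2) show ?thesis
    unfolding values_in_def by eventually_elim (use assms(3,4) in auto)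
qed

context
  fixes K l r\<^sub>0 r t
  assumes K: "regular_on K l" and r\<^sub>0: "r\<^sub>0 \<in> I" "r\<^sub>0 \<le> r" "t \<le> T"
begin

lemma l_integrable: "integrable \<mu> l" and l_nonneg: "0 \<le> l s"
  using K by (auto simp: regular_on_def)

lemma rt_subset: "{r..t} \<subseteq> I"
  using interval_subset_I[OF r\<^sub>0(1) T_in_I] r\<^sub>0 by auto

context
  fixes u
  assumes u: "u \<in> measurable (time_borel S d I) (restrict_space borel D)" "values_in K r\<^sub>0 u"
begin

lemmas driver_prems = I_subset rt_subset driver_measurable[OF u(1)] l_integrable l_nonneg
  driver_bound[OF K u(2) r\<^sub>0(2,3)]

lemma driver_set_integrable:
  "\<omega> \<in> space M \<Longrightarrow> set_integrable \<mu> {r..t} (\<lambda>s. f ((s, X s \<omega>), u (s, X s \<omega>)))"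
  by (rule path_set_integrable[OF driver_prems])

lemma driver_integral_norm_le:
  "\<omega> \<in> space M \<Longrightarrow> norm (LINT s:{r..t}|\<mu>. f ((s, X s \<omega>), u (s, X s \<omega>))) \<le> (LINT s:{r..t}|\<mu>. l s)"
  by (rule path_integral_norm_le[OF driver_prems])

lemma driver_integral_measurable:
  "(\<lambda>\<omega>. LINT s:{r..t}|\<mu>. f ((s, X s \<omega>), u (s, X s \<omega>))) \<in> borel_measurable M"
  by (rule path_integral_measurable[OF driver_prems])

lemma driver_integral_integrable:
  assumes "p \<in> {0..T} \<times> topspace S"
  shows "integrable (P p) (\<lambda>\<omega>. LINT s:{r..t}|\<mu>. f ((s, X s \<omega>), u (s, X s \<omega>)))"
  using assms driver_integral_measurable driver_integral_norm_le by (rule expectation_bound(1))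

lemma driver_norm_integral_integrable:
  assumes p: "p \<in> {0..T} \<times> topspace S"
  shows "integrable (P p) (\<lambda>\<omega>. LINT s:{r..t}|\<mu>. norm (f ((s, X s \<omega>), u (s, X s \<omega>))))"
proof -
  have "(\<lambda>p. norm (f (p, u p))) \<in> borel_measurable (time_borel S d I)"
    using driver_measurable[OF u(1)] by measurable
  note prems = I_subset rt_subset this l_integrable l_nonneg
  have "AE s in \<mu>. s \<in> {r..t} \<longrightarrow> (\<forall>y\<in>topspace S. norm (norm (f ((s, y), u (s, y)))) \<le> l s)"
    using driver_bound[OF K u(2) r\<^sub>0(2,3)] by simp
  note prems = prems this
  show ?thesis
    using p path_integral_measurable[OF prems] path_integral_norm_le[OF prems]
    by (rule expectation_bound(1))
qed

end

text \<open>The bound is stated through a general function \<open>l'\<close> of time so that it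
  covers both the piecewise constant bounds on \<open>u - v\<close> in the Gronwall step and the
  uniform bound in the passage to the limit.\<close>

lemma driver_expectation_diff:
  assumes u: "u \<in> measurable (time_borel S d I) (restrict_space borel D)" "values_in K r\<^sub>0 u"
    and v: "v \<in> measurable (time_borel S d I) (restrict_space borel D)" "values_in K r\<^sub>0 v"
    and p: "p \<in> {0..T} \<times> topspace S"
    and l': "integrable \<mu> l'" "\<And>s. 0 \<le> l' s"
      "\<And>s y. s \<in> {r..t} \<Longrightarrow> y \<in> topspace S \<Longrightarrow> l s * norm (u (s, y) - v (s, y)) \<le> l' s"
  shows "norm ((LINT \<omega>|P p. (LINT s:{r..t}|\<mu>. f ((s, X s \<omega>), u (s, X s \<omega>))))
    - (LINT \<omega>|P p. (LINT s:{r..t}|\<mu>. f ((s, X s \<omega>), v (s, X s \<omega>))))) \<le> (LINT s:{r..t}|\<mu>. l' s)"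
proof -
  let ?\<Phi> = "\<lambda>p. f (p, u p) - f (p, v p)"
  have \<Phi>: "?\<Phi> \<in> borel_measurable (time_borel S d I)"
    using driver_measurable[OF u(1)] driver_measurable[OF v(1)] by (rule borel_measurable_diff)
  have "AE s in \<mu>. \<forall>y\<in>topspace S. \<forall>v\<in>K. \<forall>v'\<in>K.
      norm (f ((s, y), v) - f ((s, y), v')) \<le> l s * norm (v - v')"
    using K unfolding regular_on_def by (auto elim: eventually_mono)
  with u(2) v(2) have bound:
    "AE s in \<mu>. s \<in> {r..t} \<longrightarrow> (\<forall>y\<in>topspace S. norm (?\<Phi> (s, y)) \<le> l' s)"
    unfolding values_in_def
  proof eventually_elim
    case (elim s)
    show ?case
    proof (intro impI ballI)
      fix y assume sy: "s \<in> {r..t}" "y \<in> topspace S"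
      then have "norm (?\<Phi> (s, y)) \<le> l s * norm (u (s, y) - v (s, y))"
        using elim r\<^sub>0 by auto
      also have "\<dots> \<le> l' s" using l'(3) sy .
      finally show "norm (?\<Phi> (s, y)) \<le> l' s" .
    qed
  qed
  note prems = I_subset rt_subset \<Phi> l'(1,2) bound
  have "(LINT \<omega>|P p. (LINT s:{r..t}|\<mu>. f ((s, X s \<omega>), u (s, X s \<omega>))))
      - (LINT \<omega>|P p. (LINT s:{r..t}|\<mu>. f ((s, X s \<omega>), v (s, X s \<omega>))))
    = (LINT \<omega>|P p. (LINT s:{r..t}|\<mu>. f ((s, X s \<omega>), u (s, X s \<omega>)))
      - (LINT s:{r..t}|\<mu>. f ((s, X s \<omega>), v (s, X s \<omega>))))"
    by (rule Bochner_Integration.integral_diff[symmetric])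
      (intro driver_integral_integrable u v p)+
  also have "\<dots> = (LINT \<omega>|P p. (LINT s:{r..t}|\<mu>. ?\<Phi> (s, X s \<omega>)))"
  proof (rule Bochner_Integration.integral_cong[OF refl])
    fix \<omega> assume "\<omega> \<in> space (P p)"
    then have "\<omega> \<in> space M" using space_P[OF p] by simp
    then show "(LINT s:{r..t}|\<mu>. f ((s, X s \<omega>), u (s, X s \<omega>)))
      - (LINT s:{r..t}|\<mu>. f ((s, X s \<omega>), v (s, X s \<omega>))) = (LINT s:{r..t}|\<mu>. ?\<Phi> (s, X s \<omega>))"
      by (intro set_integral_diff(2)[symmetric] driver_set_integrable u v)
  qed
  also have "norm \<dots> \<le> (LINT s:{r..t}|\<mu>. l' s)"
    using p path_integral_measurable[OF prems] path_integral_norm_le[OF prems]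
    by (rule expectation_bound(2))
  finally show ?thesis .
qed

end

section \<open>Tail integrals and the a priori bound\<close>

lemma tail_split:
  assumes l: "integrable \<mu> l" and r: "0 \<le> r" "r \<le> b" "b \<le> T"
  shows "(LINT s:{r..b}|\<mu>. l s) = tail l r - tail l b"
proof -
  have int: "integrable \<mu> (\<lambda>s. indicator {a..c} s *\<^sub>R l s)" if "0 \<le> a" "c \<le> T" for a c
    using that by (intro integrable_mult_indicator interval_in_sets_mu l) auto
  have "(LINT s:{r..b}|\<mu>. l s) + tail l b
      = (\<integral>s. indicator {r..b} s *\<^sub>R l s + indicator {b..T} s *\<^sub>R l s \<partial>\<mu>)"
    unfolding set_lebesgue_integral_def
    using r by (intro Bochner_Integration.integral_add[symmetric] int) auto
  also have "\<dots> = tail l r"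
    unfolding set_lebesgue_integral_def
  proof (rule integral_cong_AE)
    \<comment> \<open>The two closed intervals overlap only in \<open>b\<close>, which has no
      mass.\<close>
    show "AE s in \<mu>. indicator {r..b} s *\<^sub>R l s + indicator {b..T} s *\<^sub>R l s = indicator {r..T} s *\<^sub>R l s"
      using AE_mu_not_eq[of b] by eventually_elim (use r in \<open>auto simp: indicator_def\<close>)
    show "(\<lambda>s. indicator {r..b} s *\<^sub>R l s + indicator {b..T} s *\<^sub>R l s) \<in> borel_measurable \<mu>"
      "(\<lambda>s. indicator {r..T} s *\<^sub>R l s) \<in> borel_measurable \<mu>"
      using int[of r b] int[of b T] int[of r T] r by auto
  qed
  finally show ?thesis by simp
qed

lemma tail_singleton: "tail l T = 0"
proof -
  have "tail l T = (\<integral>s. 0 \<partial>\<mu>)"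
    unfolding set_lebesgue_integral_def
  proof (rule integral_cong_AE)
    show eq: "AE s in \<mu>. indicator {T..T} s *\<^sub>R l s = 0"
      using AE_mu_not_eq[of T] by eventually_elim auto
    \<comment> \<open>Nothing is assumed about \<open>l\<close> here; measurability holds because
      only its value at \<open>T\<close> enters.\<close>
    have "(\<lambda>s. indicator {T..T} s *\<^sub>R l s) = (\<lambda>s. indicator {T} s *\<^sub>R l T)"
      by (auto simp: indicator_def)
    moreover have "{T} \<in> sets \<mu>" using interval_in_sets_mu[of T T] T_nonneg by simp
    ultimately show "(\<lambda>s. indicator {T..T} s *\<^sub>R l s) \<in> borel_measurable \<mu>" by simp
  qed simp
  then show ?thesis by simp
qed

lemma tail_antimono:
  assumes "integrable \<mu> l" "\<And>s. 0 \<le> l s" "0 \<le> r" "r \<le> b" "b \<le> T"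
  shows "tail l b \<le> tail l r"
proof -
  have "0 \<le> (LINT s:{r..b}|\<mu>. l s)"
    unfolding set_lebesgue_integral_def using assms(2) by (intro integral_nonneg_AE AE_I2) simp
  then show ?thesis using tail_split[OF assms(1,3-5)] by simp
qed

text \<open>In the equation on \<open>[r, T]\<close> the terminal value, the driver integral and the
  residual are bounded by \<open>c\<close>, \<open>tail l r\<close> and \<open>e\<close>. The
  compact set captures the values for almost every time only, whereas this bound holds at every
  time; it provides the finite bound \<open>B\<close> in \<open>backward_gronwall\<close>.\<close>

lemma approx_sol_bound:
  assumes u: "approx_sol g \<epsilon> u" and \<epsilon>: "mu_dominated T S d \<mu> \<epsilon>"
    and e: "\<And>\<omega>. \<omega> \<in> space M \<Longrightarrow> (LINT s:{0..T}|\<mu>. \<epsilon> (s, X s \<omega>)) \<le> e"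
    and g: "\<And>x. x \<in> topspace S \<Longrightarrow> norm (g x) \<le> c"
    and K: "regular_on K l" "values_in K r\<^sub>0 u" and r: "r\<^sub>0 \<in> I" "r\<^sub>0 \<le> r" "r \<le> T"
    and x: "x \<in> topspace S"
  shows "norm (u (r, x)) \<le> c + tail l r\<^sub>0 + e"
proof -
  have rI: "r \<in> I" using interval_subset_I[OF r(1) T_in_I] r by auto
  then have p: "(r, x) \<in> {0..T} \<times> topspace S" using I_subset x by auto
  let ?E = "LINT \<omega>|P (r, x). u (T, X T \<omega>)"
  let ?F = "LINT \<omega>|P (r, x). (LINT s:{r..T}|\<mu>. f ((s, X s \<omega>), u (s, X s \<omega>)))"
  note um = approx_solD(1)[OF u]
  have "norm (?E - u (r, x) - ?F) \<le> e"
    by (rule residual_bound[OF u \<epsilon> e rI T_in_I r(3) x])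
  moreover have "norm ?E \<le> c"
  proof (rule expectation_bound(2)[OF p])
    show "(\<lambda>\<omega>. u (T, X T \<omega>)) \<in> borel_measurable M"
      by (rule slice_measurable[OF I_subset T_in_I borel_measurable_of_D[OF um]])
    show "norm (u (T, X T \<omega>)) \<le> c" if "\<omega> \<in> space M" for \<omega>
      using X_in_topspace[OF _ that] T_nonneg by (simp add: approx_solD(3)[OF u] g)
  qed
  moreover have "norm ?F \<le> tail l r"
    using p driver_integral_measurable[OF K(1) r(1,2) order_refl um K(2)]
      driver_integral_norm_le[OF K(1) r(1,2) order_refl um K(2)]
    by (rule expectation_bound(2))
  moreover have "tail l r \<le> tail l r\<^sub>0"
    using K(1) r I_subset unfolding regular_on_def by (intro tail_antimono) auto
  moreover have "norm (u (r, x)) \<le> norm ?E + norm ?F + norm (?E - u (r, x) - ?F)"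
    using norm_triangle_ineq4[of "?E - ?F" "?E - u (r, x) - ?F"] norm_triangle_ineq4[of ?E ?F]
    by (simp add: algebra_simps)
  ultimately show ?thesis by linarith
qed

text \<open>It depends on the time-only function \<open>l\<close> and the left end point alone, so
  it is common to all approximate solutions with values in the same compact set.\<close>

definition stability_const :: "(real \<Rightarrow> real) \<Rightarrow> real \<Rightarrow> real" where
  "stability_const l r = gronwall_const (tail l r) (nat \<lceil>2 * tail l r\<rceil>)"

text \<open>Subtracting the two equations on \<open>[r, T]\<close> leaves the terminal error
  \<open>a\<close>, the residuals \<open>e\<close> and \<open>e'\<close>, and a driver difference
  that the Lipschitz bound controls by \<open>l\<close> times \<open>norm (u - v)\<close>. Cutting
  this last integral at \<open>b\<close> gives precisely the step of
  \<open>backward_gronwall\<close>.\<close>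

lemma stability:
  assumes u: "approx_sol g \<epsilon> u" and \<epsilon>: "mu_dominated T S d \<mu> \<epsilon>"
    and e: "0 \<le> e" "\<And>\<omega>. \<omega> \<in> space M \<Longrightarrow> (LINT s:{0..T}|\<mu>. \<epsilon> (s, X s \<omega>)) \<le> e"
    and v: "approx_sol g' \<epsilon>' v" and \<epsilon>': "mu_dominated T S d \<mu> \<epsilon>'"
    and e': "0 \<le> e'" "\<And>\<omega>. \<omega> \<in> space M \<Longrightarrow> (LINT s:{0..T}|\<mu>. \<epsilon>' (s, X s \<omega>)) \<le> e'"
    and g: "bounded (g ` topspace S)" "bounded (g' ` topspace S)"
    and a: "0 \<le> a" "\<And>x. x \<in> topspace S \<Longrightarrow> norm (g x - g' x) \<le> a"
    and K: "regular_on K l" "values_in K r\<^sub>0 u" "values_in K r\<^sub>0 v"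
    and r: "r\<^sub>0 \<in> I" "r \<in> {r\<^sub>0..T}" and x: "x \<in> topspace S"
  shows "norm (u (r, x) - v (r, x)) \<le> stability_const l r\<^sub>0 * (a + e + e')"
proof -
  have l: "integrable \<mu> l" "\<And>s. 0 \<le> l s" using K(1) by (auto simp: regular_on_def)
  have r\<^sub>0: "0 \<le> r\<^sub>0" "r\<^sub>0 \<le> T" using r I_subset by auto
  obtain c where c: "\<And>x. x \<in> topspace S \<Longrightarrow> norm (g x) \<le> c"
    using g(1) by (auto simp: bounded_iff)
  obtain c' where c': "\<And>x. x \<in> topspace S \<Longrightarrow> norm (g' x) \<le> c'"
    using g(2) by (auto simp: bounded_iff)
  show ?thesis
    unfolding stability_const_def
  proof (rule backward_gronwall[where G = "tail l" and a = r\<^sub>0 and Y = "topspace S"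
        and \<phi> = "\<lambda>r x. norm (u (r, x) - v (r, x))"
        and B = "(c + tail l r\<^sub>0 + e) + (c' + tail l r\<^sub>0 + e')"])
    show "continuous_on {r\<^sub>0..T} (tail l)"
      using continuous_on_tail_integral[OF l(1)] by (rule continuous_on_subset) (use r\<^sub>0 in auto)
    show "antimono_on {r\<^sub>0..T} (tail l)"
      using r\<^sub>0 by (intro monotone_onI tail_antimono l) auto
    show "tail l T = 0" by (rule tail_singleton)
    show "norm (u (s, y) - v (s, y)) \<le> (c + tail l r\<^sub>0 + e) + (c' + tail l r\<^sub>0 + e')"
      if "s \<in> {r\<^sub>0..T}" "y \<in> topspace S" for s y
    proof -
      have "norm (u (s, y)) \<le> c + tail l r\<^sub>0 + e"
        by (rule approx_sol_bound[OF u \<epsilon> e(2) c K(1,2) r(1)]) (use that in auto)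
      moreover have "norm (v (s, y)) \<le> c' + tail l r\<^sub>0 + e'"
        by (rule approx_sol_bound[OF v \<epsilon>' e'(2) c' K(1,3) r(1)]) (use that in auto)
      ultimately show ?thesis using norm_triangle_ineq4[of "u (s, y)" "v (s, y)"] by linarith
    qed
    show "0 \<le> a + e + e'" using a e e' by simp
    fix r b A A' x
    assume rb: "r\<^sub>0 \<le> r" "r \<le> b" "b \<le> T" and A: "0 \<le> A" "0 \<le> A'" and x: "x \<in> topspace S"
      and le_A: "\<And>s y. s \<in> {r..b} \<Longrightarrow> y \<in> topspace S \<Longrightarrow> norm (u (s, y) - v (s, y)) \<le> A"
      and le_A': "\<And>s y. s \<in> {b..T} \<Longrightarrow> y \<in> topspace S \<Longrightarrow> norm (u (s, y) - v (s, y)) \<le> A'"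
    have rI: "r \<in> I" and rT: "r \<le> T" using interval_subset_I[OF r(1) T_in_I] rb by auto
    then have p: "(r, x) \<in> {0..T} \<times> topspace S" using I_subset x by auto
    let ?E = "\<lambda>u. LINT \<omega>|P (r, x). u (T, X T \<omega>)"
    let ?F = "\<lambda>u. LINT \<omega>|P (r, x). (LINT s:{r..T}|\<mu>. f ((s, X s \<omega>), u (s, X s \<omega>)))"
    have "norm (?E u - u (r, x) - ?F u) \<le> e"
      by (rule residual_bound[OF u \<epsilon> e(2) rI T_in_I rT x])
    moreover have "norm (?E v - v (r, x) - ?F v) \<le> e'"
      by (rule residual_bound[OF v \<epsilon>' e'(2) rI T_in_I rT x])
    moreover have "norm (?E u - ?E v) \<le> a"
    proof -
      have "?E u - ?E v = (LINT \<omega>|P (r, x). u (T, X T \<omega>) - v (T, X T \<omega>))"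
        by (intro Bochner_Integration.integral_diff[symmetric] integrable_value[OF u]
            integrable_value[OF v] rI T_in_I rT x)
      also have "norm \<dots> \<le> a"
      proof (rule expectation_bound(2)[OF p])
        show "(\<lambda>\<omega>. u (T, X T \<omega>) - v (T, X T \<omega>)) \<in> borel_measurable M"
          by (intro borel_measurable_diff slice_measurable[OF I_subset T_in_I]
              borel_measurable_of_D approx_solD(1)[OF u] approx_solD(1)[OF v])
        show "norm (u (T, X T \<omega>) - v (T, X T \<omega>)) \<le> a" if "\<omega> \<in> space M" for \<omega>
          using X_in_topspace[OF _ that] T_nonneg
          by (simp add: approx_solD(3)[OF u] approx_solD(3)[OF v] a)
      qed
      finally show ?thesis .
    qed
    moreover have "norm (?F u - ?F v) \<le> A * (tail l r - tail l b) + A' * tail l b"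
    proof -
      \<comment> \<open>The Lipschitz function weighted with the bound \<open>A\<close> before
        \<open>b\<close> and \<open>A'\<close> after \<open>b\<close>. At \<open>b\<close> itself
        both terms count, which only enlarges the bound.\<close>
      define l' where "l' s = A * (indicator {r..b} s * l s) + A' * (indicator {b..T} s * l s)" for s
      have int: "integrable \<mu> (\<lambda>s. indicator {a..c} s * l s)" if "0 \<le> a" "c \<le> T" for a c
        using integrable_mult_indicator[OF interval_in_sets_mu l(1), of a c] that by auto
      have ints: "integrable \<mu> (\<lambda>s. indicator {r..b} s * l s)" "integrable \<mu> (\<lambda>s. indicator {b..T} s * l s)"
        using rb r\<^sub>0 by (auto intro!: int)
      have "norm (?F u - ?F v) \<le> (LINT s:{r..T}|\<mu>. l' s)"
      proof (rule driver_expectation_diff[OF K(1) r(1) rb(1) order_refl approx_solD(1)[OF u] K(2)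
            approx_solD(1)[OF v] K(3) p])
        show "integrable \<mu> l'" unfolding l'_def using ints by simp
        show "0 \<le> l' s" for s unfolding l'_def using A l by simp
        fix s y assume sy: "s \<in> {r..T}" "y \<in> topspace S"
        let ?n = "norm (u (s, y) - v (s, y))"
        show "l s * ?n \<le> l' s"
        proof (cases "s \<le> b")
          case True
          then have "l s * ?n \<le> l s * A" using sy l by (intro mult_left_mono le_A) auto
          moreover have "0 \<le> A' * (indicator {b..T} s * l s)" using A l by simp
          ultimately show ?thesis using True sy by (simp add: l'_def mult.commute)
        next
          case False
          then have "l s * ?n \<le> l s * A'" using sy l by (intro mult_left_mono le_A') auto
          then show ?thesis using False sy by (simp add: l'_def mult.commute)
        qed
      qed
      also have "(LINT s:{r..T}|\<mu>. l' s) = (\<integral>s. l' s \<partial>\<mu>)"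
        unfolding set_lebesgue_integral_def
        using rb by (intro Bochner_Integration.integral_cong) (auto simp: l'_def indicator_def)
      also have "\<dots> = A * (LINT s:{r..b}|\<mu>. l s) + A' * tail l b"
        unfolding l'_def set_lebesgue_integral_def using ints by simp
      also have "(LINT s:{r..b}|\<mu>. l s) = tail l r - tail l b"
        using l(1) rb r\<^sub>0 by (intro tail_split) auto
      finally show ?thesis .
    qed
    moreover have "norm (u (r, x) - v (r, x)) \<le> norm (?E u - ?E v) + norm (?F u - ?F v)
        + (norm (?E u - u (r, x) - ?F u) + norm (?E v - v (r, x) - ?F v))"
      by (rule norm_triangle_rearrange)
    ultimately show "norm (u (r, x) - v (r, x)) \<le> a + e + e' + A * (tail l r - tail l b) + A' * tail l b"
      by linarith
  qed (use r x in auto)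
qed

section \<open>Passage to the limit, uniqueness and the Cauchy property\<close>

lemma mu_dominated_zero: "mu_dominated T S d \<mu> (\<lambda>_. 0)"
  unfolding mu_dominated_def
  by (intro conjI exI[of _ "\<lambda>_. 0"]) (auto intro!: measurable_const)

text \<open>Measurability, consistency and the terminal value pass to the pointwise limit. In the
  equation, uniform convergence on \<open>[r, T]\<close> controls the values and their expectations,
  and the Lipschitz bound on a common \<open>K\<close> controls the drivers, so the residual of
  \<open>u\<close> is the limit of residuals that tend to zero.\<close>

lemma uniform_limit_imp_solution:
  assumes un: "\<And>n. approx_sol (gn n) (\<epsilon> n) (un n)" and \<epsilon>: "\<And>n. mu_dominated T S d \<mu> (\<epsilon> n)"
    and lim_\<epsilon>: "uniform_limit (space M) (\<lambda>n \<omega>. LINT t:{0..T}|\<mu>. \<epsilon> n (t, X t \<omega>)) (\<lambda>_. 0) sequentially"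
    and lim_g: "\<And>x. x \<in> topspace S \<Longrightarrow> (\<lambda>n. gn n x) \<longlonglongrightarrow> g x"
    and lim_u: "\<And>r. r \<in> I \<Longrightarrow> uniform_limit ({r..T} \<times> topspace S) un u sequentially"
    and uD: "\<And>p. p \<in> I \<times> topspace S \<Longrightarrow> u p \<in> D"
    and K: "\<And>r. r \<in> I \<Longrightarrow> \<exists>K l. regular_on K l \<and> values_in K r u \<and> (\<forall>n. values_in K r (un n))"
  shows "solution T S d M X P \<mu> D f g I u"
proof -
  have lim: "(\<lambda>n. un n p) \<longlonglongrightarrow> u p" if "p \<in> I \<times> topspace S" for p
  proof -
    obtain s y where p: "p = (s, y)" "s \<in> I" "y \<in> topspace S"
      using \<open>p \<in> I \<times> topspace S\<close> by auto
    show ?thesis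
      by (rule tendsto_uniform_limitI[OF lim_u[OF p(2)]]) (use p I_subset in auto)
  qed
  have um: "u \<in> measurable (time_borel S d I) (restrict_space borel D)"
  proof (rule measurable_restrict_space2)
    show "u \<in> space (time_borel S d I) \<rightarrow> D" using uD by simp
    show "u \<in> borel_measurable (time_borel S d I)"
      using borel_measurable_of_D[OF approx_solD(1)[OF un]] lim
      by (rule borel_measurable_LIMSEQ_metric) simp
  qed
  have cons: "consistent_on S d I u"
    unfolding consistent_on_def
  proof (intro ballI impI)
    fix p q assume pq: "p \<in> I \<times> topspace S" "q \<in> I \<times> topspace S" "d p q = 0"
    then have "un n p = un n q" for n
      using approx_solD(2)[OF un[of n]] unfolding consistent_on_def by blast
    then have "(\<lambda>n. un n p) \<longlonglongrightarrow> u q" using lim[OF pq(2)] by simp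
    then show "u p = u q" by (rule LIMSEQ_unique[OF lim[OF pq(1)]])
  qed
  have terminal: "u (T, x) = g x" if "x \<in> topspace S" for x
  proof (rule LIMSEQ_unique)
    show "(\<lambda>n. un n (T, x)) \<longlonglongrightarrow> u (T, x)" using lim T_in_I that by simp
    show "(\<lambda>n. un n (T, x)) \<longlonglongrightarrow> g x" using lim_g[OF that] approx_solD(3)[OF un that] by simp
  qed
  have "integrable (P (r, x)) (\<lambda>\<omega>. norm (u (t, X t \<omega>))) \<and>
      (\<forall>\<omega>\<in>space M. set_integrable \<mu> {r..t} (\<lambda>s. f ((s, X s \<omega>), u (s, X s \<omega>)))) \<and>
      integrable (P (r, x)) (\<lambda>\<omega>. LINT s:{r..t}|\<mu>. norm (f ((s, X s \<omega>), u (s, X s \<omega>)))) \<and>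
      norm ((LINT \<omega>|P (r, x). u (t, X t \<omega>)) - u (r, x)
            - (LINT \<omega>|P (r, x). (LINT s:{r..t}|\<mu>. f ((s, X s \<omega>), u (s, X s \<omega>))))) \<le> 0"
    if rt: "r \<in> I" "t \<in> I" "r \<le> t" and x: "x \<in> topspace S" for r t x
  proof -
    obtain K l where K: "regular_on K l" "values_in K r u" "\<And>n. values_in K r (un n)"
      using assms(7)[OF rt(1)] by blast
    have l: "integrable \<mu> l" "\<And>s. 0 \<le> l s" using K(1) by (auto simp: regular_on_def)
    have tT: "t \<le> T" using rt I_subset by auto
    have p: "(r, x) \<in> {0..T} \<times> topspace S" using rt x I_subset by auto
    note driver_args = K(1) rt(1) order_refl tT
    let ?E = "\<lambda>u. LINT \<omega>|P (r, x). u (t, X t \<omega>)"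
    let ?F = "\<lambda>u. LINT \<omega>|P (r, x). (LINT s:{r..t}|\<mu>. f ((s, X s \<omega>), u (s, X s \<omega>)))"
    have close: "\<forall>\<^sub>F n in sequentially. \<forall>s\<in>{r..T}. \<forall>y\<in>topspace S. norm (un n (s, y) - u (s, y)) \<le> \<eta>"
      if "0 < \<eta>" for \<eta>
      using uniform_limitD[OF lim_u[OF rt(1)] that]
      by eventually_elim (auto simp: dist_norm intro: less_imp_le)
    have diff_m: "(\<lambda>\<omega>. un n (t, X t \<omega>) - u (t, X t \<omega>)) \<in> borel_measurable M" for n
      by (intro borel_measurable_diff slice_measurable[OF I_subset rt(2)]
          borel_measurable_of_D um approx_solD(1)[OF un])
    have diff: "integrable (P (r, x)) (\<lambda>\<omega>. un n (t, X t \<omega>) - u (t, X t \<omega>))"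
        "norm (LINT \<omega>|P (r, x). un n (t, X t \<omega>) - u (t, X t \<omega>)) \<le> \<eta>"
      if n\<eta>: "\<forall>s\<in>{r..T}. \<forall>y\<in>topspace S. norm (un n (s, y) - u (s, y)) \<le> \<eta>" for n \<eta>
    proof -
      have "norm (un n (t, X t \<omega>) - u (t, X t \<omega>)) \<le> \<eta>" if "\<omega> \<in> space M" for \<omega>
        using n\<eta> X_in_topspace[OF _ that] rt tT I_subset by auto
      from expectation_bound[OF p diff_m this]
      show "integrable (P (r, x)) (\<lambda>\<omega>. un n (t, X t \<omega>) - u (t, X t \<omega>))"
        "norm (LINT \<omega>|P (r, x). un n (t, X t \<omega>) - u (t, X t \<omega>)) \<le> \<eta>" by auto
    qed
    \<comment> \<open>Some \<open>un n\<close> is within distance 1 of \<open>u\<close>, and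
      \<open>u\<close> is the integrable \<open>un n\<close> minus a bounded difference.\<close>
    have int_u: "integrable (P (r, x)) (\<lambda>\<omega>. u (t, X t \<omega>))"
    proof -
      obtain n where n: "\<forall>s\<in>{r..T}. \<forall>y\<in>topspace S. norm (un n (s, y) - u (s, y)) \<le> 1"
        using eventually_happens'[OF sequentially_bot close[of 1]] by auto
      show ?thesis
        using Bochner_Integration.integrable_diff[OF integrable_value[OF un[of n] rt x] diff(1)[OF n]] by simp
    qed
    define L where "L = (LINT s:{r..t}|\<mu>. l s)"
    have L: "0 \<le> L"
      unfolding L_def set_lebesgue_integral_def using l(2) by (intro integral_nonneg_AE AE_I2) simp
    have "norm (?E u - u (r, x) - ?F u) \<le> 0"
    proof (rule field_le_epsilon)
      fix e :: real assume e: "0 < e"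
      \<comment> \<open>Three errors of size \<open>\<eta>\<close> arise, from the residual of
        \<open>un n\<close>, the expected value and the value at \<open>r\<close>. The driver
        contributes \<open>L * \<eta>\<close>.\<close>
      define \<eta> where "\<eta> = e / (3 + L)"
      have \<eta>: "0 < \<eta>" unfolding \<eta>_def using e L by simp
      have "\<exists>n. (\<forall>s\<in>{r..T}. \<forall>y\<in>topspace S. norm (un n (s, y) - u (s, y)) \<le> \<eta>) \<and>
        (\<forall>\<omega>\<in>space M. dist (LINT t:{0..T}|\<mu>. \<epsilon> n (t, X t \<omega>)) 0 < \<eta>)"
        by (intro eventually_happens'[OF sequentially_bot] eventually_conj close
            uniform_limitD[OF lim_\<epsilon>] \<eta>)
      then obtain n where n: "\<forall>s\<in>{r..T}. \<forall>y\<in>topspace S. norm (un n (s, y) - u (s, y)) \<le> \<eta>"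
        "\<And>\<omega>. \<omega> \<in> space M \<Longrightarrow> (LINT t:{0..T}|\<mu>. \<epsilon> n (t, X t \<omega>)) \<le> \<eta>"
        by fastforce
      have "norm (?E (un n) - un n (r, x) - ?F (un n)) \<le> \<eta>"
        by (rule residual_bound[OF un \<epsilon> n(2) rt x])
      moreover have "norm (?E (un n) - ?E u) \<le> \<eta>"
        using diff(2)[OF n(1)] integrable_value[OF un[of n] rt x] int_u by simp
      moreover have "norm (un n (r, x) - u (r, x)) \<le> \<eta>" using n(1) rt tT x by auto
      moreover have "norm (?F (un n) - ?F u) \<le> (LINT s:{r..t}|\<mu>. l s * \<eta>)"
        using n(1) tT l \<eta>
        by (intro driver_expectation_diff[OF driver_args approx_solD(1)[OF un] K(3) um K(2) p])
          (auto intro!: mult_left_mono)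
      then have "norm (?F (un n) - ?F u) \<le> L * \<eta>" by (simp add: L_def)
      moreover have "norm (?E u - u (r, x) - ?F u) \<le> norm (?E (un n) - un n (r, x) - ?F (un n))
          + (norm (?E (un n) - ?E u) + norm (un n (r, x) - u (r, x)) + norm (?F (un n) - ?F u))"
        by (rule norm_triangle_perturb)
      ultimately have "norm (?E u - u (r, x) - ?F u) \<le> (3 + L) * \<eta>"
        by (simp add: algebra_simps)
      then show "norm (?E u - u (r, x) - ?F u) \<le> 0 + e" using L by (simp add: \<eta>_def)
    qed
    moreover have "\<forall>\<omega>\<in>space M. set_integrable \<mu> {r..t} (\<lambda>s. f ((s, X s \<omega>), u (s, X s \<omega>)))"
      using driver_set_integrable[OF driver_args um K(2)] by blast
    moreover have "integrable (P (r, x)) (\<lambda>\<omega>. LINT s:{r..t}|\<mu>. norm (f ((s, X s \<omega>), u (s, X s \<omega>))))"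
      by (rule driver_norm_integral_integrable[OF driver_args um K(2) p])
    ultimately show ?thesis using int_u by simp
  qed
  then show ?thesis
    unfolding solution_def approx_solution_def
    using um cons terminal by (simp add: set_lebesgue_integral_def)
qed

text \<open>On \<open>[r, T]\<close> the values of both solutions lie almost everywhere in the union
  of two compact subsets of \<open>D\<close>, so \<open>stability\<close> applies with all errors
  equal to zero and gives equality at every point.\<close>

lemma solution_unique:
  assumes u: "solution T S d M X P \<mu> D f g I u" "mu_admissible T S \<mu> D I u"
    and v: "solution T S d M X P \<mu> D f g I v" "mu_admissible T S \<mu> D I v"
    and g: "bounded (g ` topspace S)" and p: "p \<in> I \<times> topspace S"
  shows "u p = v p"
proof -
  obtain r x where rx: "p = (r, x)" "r \<in> I" "x \<in> topspace S" using p by auto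
  have adm: "\<exists>K. compact K \<and> K \<subseteq> D \<and> values_in K r w" if w: "mu_admissible T S \<mu> D I w" for w
  proof -
    obtain N where N: "N \<in> null_sets \<mu>"
      and K: "compact (closure (w ` (({r..T} - N) \<times> topspace S)))"
        "closure (w ` (({r..T} - N) \<times> topspace S)) \<subseteq> D"
      using w rx(2) unfolding mu_admissible_def by blast
    have "values_in (closure (w ` (({r..T} - N) \<times> topspace S))) r w"
      unfolding values_in_def using AE_not_in[OF N]
      by eventually_elim (auto intro!: closure_subset[THEN subsetD])
    then show ?thesis using K by blast
  qed
  obtain K\<^sub>1 where K\<^sub>1: "compact K\<^sub>1" "K\<^sub>1 \<subseteq> D" "values_in K\<^sub>1 r u" using adm[OF u(2)] by blast
  obtain K\<^sub>2 where K\<^sub>2: "compact K\<^sub>2" "K\<^sub>2 \<subseteq> D" "values_in K\<^sub>2 r v" using adm[OF v(2)] by blast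
  obtain l where l: "regular_on (K\<^sub>1 \<union> K\<^sub>2) l"
    using compact_regularity[of "K\<^sub>1 \<union> K\<^sub>2"] K\<^sub>1 K\<^sub>2 by (metis Un_least compact_Un)
  have "values_in (K\<^sub>1 \<union> K\<^sub>2) r u"
    using K\<^sub>1(3) unfolding values_in_def by eventually_elim blast
  moreover have "values_in (K\<^sub>1 \<union> K\<^sub>2) r v"
    using K\<^sub>2(3) unfolding values_in_def by eventually_elim blast
  ultimately have vals: "values_in (K\<^sub>1 \<union> K\<^sub>2) r u" "values_in (K\<^sub>1 \<union> K\<^sub>2) r v" .
  have "norm (u (r, x) - v (r, x)) \<le> stability_const l r * (0 + 0 + 0)"
    by (rule stability[OF u(1)[unfolded solution_def] mu_dominated_zero order_refl _
          v(1)[unfolded solution_def] mu_dominated_zero order_refl _ g g order_refl _ l vals rx(2)])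
      (use rx I_subset in \<open>auto simp: set_lebesgue_integral_def\<close>)
  then show ?thesis by (simp add: rx)
qed

text \<open>All \<open>un n\<close> share \<open>K\<close> and \<open>l\<close>, so one stability
  constant serves every pair, while the terminal errors and the residuals become uniformly
  small.\<close>

lemma approx_sol_uniformly_Cauchy:
  assumes un: "\<And>n. approx_sol (gn n) (\<epsilon> n) (un n)" and \<epsilon>: "\<And>n. mu_dominated T S d \<mu> (\<epsilon> n)"
    and lim_\<epsilon>: "uniform_limit (space M) (\<lambda>n \<omega>. LINT t:{0..T}|\<mu>. \<epsilon> n (t, X t \<omega>)) (\<lambda>_. 0) sequentially"
    and lim_g: "uniform_limit (topspace S) gn g sequentially"
    and gn: "\<And>n. bounded (gn n ` topspace S)"
    and r: "r \<in> I" and K: "regular_on K l" "\<And>n. values_in K r (un n)"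
  shows "uniformly_Cauchy_on ({r..T} \<times> topspace S) un"
proof (rule uniformly_Cauchy_onI)
  fix e :: real assume e: "0 < e"
  define c where "c = stability_const l r"
  have "tail l T \<le> tail l r"
    using K(1) r I_subset unfolding regular_on_def by (intro tail_antimono) auto
  then have "0 \<le> tail l r" using tail_singleton[of l] by linarith
  then have c: "0 \<le> c" unfolding c_def stability_const_def by (rule gronwall_const_nonneg)
  \<comment> \<open>Two terminal values within \<open>\<eta>\<close> of the limit differ by at most
    \<open>2 * \<eta>\<close>, and each residual adds \<open>\<eta>\<close>. The summand 1 guards
    against \<open>c = 0\<close>.\<close>
  define \<eta> where "\<eta> = e / (4 * (c + 1))"
  have \<eta>: "0 < \<eta>" unfolding \<eta>_def using e c by simp
  have "4 * (c + 1) \<noteq> 0" using c by simp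
  then have "\<eta> * (4 * (c + 1)) = e" using \<eta>_def nonzero_eq_divide_eq by blast
  then have c\<eta>: "c * (2 * \<eta> + \<eta> + \<eta>) < e" using \<eta> by (simp add: algebra_simps)
  have "\<forall>\<^sub>F n in sequentially. (\<forall>x\<in>topspace S. dist (gn n x) (g x) < \<eta>) \<and>
      (\<forall>\<omega>\<in>space M. dist (LINT t:{0..T}|\<mu>. \<epsilon> n (t, X t \<omega>)) 0 < \<eta>)"
    by (intro eventually_conj uniform_limitD[OF lim_g] uniform_limitD[OF lim_\<epsilon>] \<eta>)
  then obtain N where N: "\<And>n x. N \<le> n \<Longrightarrow> x \<in> topspace S \<Longrightarrow> dist (gn n x) (g x) < \<eta>"
    "\<And>n \<omega>. N \<le> n \<Longrightarrow> \<omega> \<in> space M \<Longrightarrow> dist (LINT t:{0..T}|\<mu>. \<epsilon> n (t, X t \<omega>)) 0 < \<eta>"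
    unfolding eventually_sequentially by blast
  have \<epsilon>_le: "(LINT t:{0..T}|\<mu>. \<epsilon> n (t, X t \<omega>)) \<le> \<eta>" if "N \<le> n" "\<omega> \<in> space M" for n \<omega>
    using N(2)[OF that] by simp
  have g_le: "norm (gn m x - gn n x) \<le> 2 * \<eta>" if "N \<le> m" "N \<le> n" "x \<in> topspace S" for m n x
    using N(1)[OF that(1,3)] N(1)[OF that(2,3)] dist_triangle2[of "gn m x" "gn n x" "g x"]
    by (simp add: dist_norm)
  have "dist (un m p) (un n p) < e" if mn: "N \<le> m" "N \<le> n" and p: "p \<in> {r..T} \<times> topspace S" for m n p
  proof -
    obtain s y where sy: "p = (s, y)" "s \<in> {r..T}" "y \<in> topspace S" using p by auto
    have "norm (un m (s, y) - un n (s, y)) \<le> stability_const l r * (2 * \<eta> + \<eta> + \<eta>)"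
      using \<eta> mn \<epsilon>_le g_le sy
      by (intro stability[OF un \<epsilon> _ _ un \<epsilon> _ _ gn gn _ _ K(1) K(2) K(2) r]) auto
    then show ?thesis using c\<eta> by (simp add: c_def sy dist_norm)
  qed
  then show "\<exists>N. \<forall>x\<in>{r..T} \<times> topspace S. \<forall>m\<ge>N. \<forall>n\<ge>N. dist (un m x) (un n x) < e" by blast
qed

end

section \<open>Convergence to the unique admissible solution\<close>

theorem proposition3p4:
  fixes T :: real
    and S :: "'s topology"
    and d :: "real \<times> 's \<Rightarrow> real \<times> 's \<Rightarrow> real"
    and \<mu> :: "real measure"
    and M :: "'w measure"
    and F :: "real \<Rightarrow> 'w measure"
    and X :: "real \<Rightarrow> 'w \<Rightarrow> 's"
    and P :: "real \<times> 's \<Rightarrow> 'w measure"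
    and D :: "(real ^ 'k) set"
    and f :: "(real \<times> 's) \<times> (real ^ 'k) \<Rightarrow> real ^ 'k"
    and g :: "'s \<Rightarrow> real ^ 'k"
    and I :: "real set"
    and \<epsilon> :: "nat \<Rightarrow> real \<times> 's \<Rightarrow> real"
    and gn :: "nat \<Rightarrow> 's \<Rightarrow> real ^ 'k"
    and un :: "nat \<Rightarrow> real \<times> 's \<Rightarrow> real ^ 'k"
  assumes T_pos: "0 < T"
    and S: "metrizable_space S" "separable_space S"
    and d: "pseudometric_on ({0..T} \<times> topspace S) d"
    and d_coarser: "\<And>U. openin (pseudometric_topology ({0..T} \<times> topspace S) d) U \<Longrightarrow>
      openin (prod_topology (top_of_set {0..T}) S) U"
    and mu: "sets \<mu> = sets (restrict_space borel {0..T})" "atomless \<mu>"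
    and process: "progressive_markov_process T S d M F X P"
    and D: "D \<in> sets borel" "interior D \<noteq> {}"
    and g: "g \<in> bounded_borel_maps S D" "terminal_consistent T S d g"
    and f: "f \<in> BC1minus T S d \<mu> D"
    and I: "admissible_interval T I"
    and eps: "\<And>n. mu_dominated T S d \<mu> (\<epsilon> n)"
    and gn: "\<And>n. gn n \<in> bounded_borel_maps S D" "\<And>n. terminal_consistent T S d (gn n)"
    and un: "\<And>n. approx_solution T S d M X P \<mu> D f (gn n) (\<epsilon> n) I (un n)"
    and i_g: "uniform_limit (topspace S) gn g sequentially"
    and i_eps: "uniform_limit (space M) (\<lambda>n \<omega>. LINT t:{0..T}|\<mu>. \<epsilon> n (t, X t \<omega>)) (\<lambda>_. 0) sequentially"
    and ii: "\<And>r x. r \<in> I \<Longrightarrow> x \<in> topspace S \<Longrightarrow> closure (range (\<lambda>n. un n (r, x))) \<subseteq> D"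
    and iii: "\<And>r. r \<in> I \<Longrightarrow> \<exists>K. compact K \<and> K \<subseteq> D \<and>
      (AE s in \<mu>. s \<in> {r..T} \<longrightarrow> (\<forall>n. \<forall>y\<in>topspace S. un n (s, y) \<in> K))"
  shows "\<exists>u. solution T S d M X P \<mu> D f g I u \<and> mu_admissible T S \<mu> D I u \<and>
    (\<forall>v. solution T S d M X P \<mu> D f g I v \<and> mu_admissible T S \<mu> D I v \<longrightarrow>
       (\<forall>p \<in> I \<times> topspace S. v p = u p)) \<and>
    (\<forall>r\<in>I. uniform_limit ({r..T} \<times> topspace S) un u sequentially)"
proof -
  interpret progressive_markov_process T S d M F X P by (rule process)
  interpret markovian_equation T S d M F X P \<mu> D f I
    by unfold_locales (fact S d d_coarser mu f I)+
  have bounded_g: "bounded (g ` topspace S)" and bounded_gn: "bounded (gn n ` topspace S)" for n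
    using g(1) gn(1)[of n] by (auto simp: bounded_borel_maps_def)
  \<comment> \<open>The pointwise limit does not refer to \<open>r\<close>, so the uniform limits on
    the different sets \<open>[r, T] \<times> S\<close> are restrictions of one map.\<close>
  define u where "u p = lim (\<lambda>n. un n p)" for p
  have lim_u: "uniform_limit ({r..T} \<times> topspace S) un u sequentially" if r: "r \<in> I" for r
  proof -
    obtain K where K: "compact K" "K \<subseteq> D"
      "AE s in \<mu>. s \<in> {r..T} \<longrightarrow> (\<forall>n. \<forall>y\<in>topspace S. un n (s, y) \<in> K)"
      using iii[OF r] by blast
    obtain l where l: "regular_on K l" using compact_regularity[OF K(1,2)] .
    have "values_in K r (un n)" for n
      unfolding values_in_def using K(3) by eventually_elim blast
    from approx_sol_uniformly_Cauchy[OF un eps i_eps i_g bounded_gn r l this]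
    have "uniformly_convergent_on ({r..T} \<times> topspace S) un" by (rule Cauchy_uniformly_convergent)
    then show ?thesis unfolding u_def uniformly_convergent_uniform_limit_iff .
  qed
  have lim: "(\<lambda>n. un n (s, y)) \<longlonglongrightarrow> u (s, y)" if "s \<in> I" "y \<in> topspace S" for s y
    by (rule tendsto_uniform_limitI[OF lim_u[OF that(1)]]) (use that I_subset in auto)
  \<comment> \<open>The compact sets of (iii) control almost every time only; at the exceptional
    times it is (ii) that keeps the limit in \<open>D\<close>.\<close>
  have uD: "u p \<in> D" if "p \<in> I \<times> topspace S" for p
  proof -
    obtain s y where p: "p = (s, y)" "s \<in> I" "y \<in> topspace S" using \<open>p \<in> I \<times> topspace S\<close> by auto
    have "u (s, y) \<in> closure (range (\<lambda>n. un n (s, y)))"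
      unfolding closure_sequential using lim[OF p(2,3)]
      by (intro exI[of _ "\<lambda>n. un n (s, y)"]) simp
    then show ?thesis using ii[OF p(2,3)] p(1) by auto
  qed
  \<comment> \<open>The null set in (iii) is common to all \<open>n\<close>, and the closed set
    \<open>K\<close> retains the limit at every other time.\<close>
  have u_in_K: "AE s in \<mu>. s \<in> {r..T} \<longrightarrow> (\<forall>y\<in>topspace S. u (s, y) \<in> K)"
    if r: "r \<in> I" and K: "compact K"
      and un_in_K: "AE s in \<mu>. s \<in> {r..T} \<longrightarrow> (\<forall>n. \<forall>y\<in>topspace S. un n (s, y) \<in> K)" for r K
    using un_in_K
  proof eventually_elim
    case (elim s)
    show ?case
    proof (intro impI ballI)
      fix y assume sy: "s \<in> {r..T}" "y \<in> topspace S"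
      then have "s \<in> I" using interval_subset_I[OF r T_in_I] by auto
      from closed_sequentially[OF compact_imp_closed[OF K] _ lim[OF this sy(2)]]
      show "u (s, y) \<in> K" using elim sy by blast
    qed
  qed
  have sol: "solution T S d M X P \<mu> D f g I u"
  proof (rule uniform_limit_imp_solution[OF un eps i_eps _ lim_u uD])
    show "(\<lambda>n. gn n x) \<longlonglongrightarrow> g x" if "x \<in> topspace S" for x
      using tendsto_uniform_limitI[OF i_g that] .
    show "\<exists>K l. regular_on K l \<and> values_in K r u \<and> (\<forall>n. values_in K r (un n))" if r: "r \<in> I" for r
    proof -
      obtain K where K: "compact K" "K \<subseteq> D"
        "AE s in \<mu>. s \<in> {r..T} \<longrightarrow> (\<forall>n. \<forall>y\<in>topspace S. un n (s, y) \<in> K)"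
        using iii[OF r] by blast
      obtain l where l: "regular_on K l" using compact_regularity[OF K(1,2)] .
      have "values_in K r (un n)" for n
        unfolding values_in_def using K(3) by eventually_elim blast
      moreover have "values_in K r u"
        unfolding values_in_def by (rule u_in_K[OF r K(1,3)])
      ultimately show ?thesis using l by blast
    qed
  qed
  have adm: "mu_admissible T S \<mu> D I u"
    unfolding mu_admissible_def
  proof
    fix r assume r: "r \<in> I"
    obtain K where K: "compact K" "K \<subseteq> D"
      "AE s in \<mu>. s \<in> {r..T} \<longrightarrow> (\<forall>n. \<forall>y\<in>topspace S. un n (s, y) \<in> K)"
      using iii[OF r] by blast
    obtain N where N: "N \<in> null_sets \<mu>"
      "{s \<in> space \<mu>. \<not> (s \<in> {r..T} \<longrightarrow> (\<forall>y\<in>topspace S. u (s, y) \<in> K))} \<subseteq> N"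
      using u_in_K[OF r K(1,3)] unfolding eventually_ae_filter by blast
    have "{r..T} \<subseteq> space \<mu>" using r I_subset by (auto simp: space_mu)
    then have "u ` (({r..T} - N) \<times> topspace S) \<subseteq> K" using N(2) by blast
    \<comment> \<open>The image itself need not be closed; its closure is a closed subset of
      \<open>K\<close>, hence compact and contained in \<open>D\<close>.\<close>
    then have sub: "closure (u ` (({r..T} - N) \<times> topspace S)) \<subseteq> K"
      using K(1) by (intro closure_minimal compact_imp_closed)
    then have "compact (closure (u ` (({r..T} - N) \<times> topspace S)))"
      using K(1) compact_Int_closed[OF K(1) closed_closure] by (metis inf.absorb2)
    then show "\<exists>N\<in>null_sets \<mu>. compact (closure (u ` (({r..T} - N) \<times> topspace S))) \<and>
        closure (u ` (({r..T} - N) \<times> topspace S)) \<subseteq> D"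
      using N(1) sub K(2) by blast
  qed
  show ?thesis
    using sol adm lim_u solution_unique[OF _ _ sol adm bounded_g] by blast
qed

end
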